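(* Let $L$ be a finite-dimensional complex Leibniz algebra and let $I$ be the ideal of $L$ generated by all squares $[x,x]$, $x\in L$. Suppose that: (a) $L/I\cong sl_2^1\oplus sl_2^2$, where $sl_2^1,sl_2^2$ are two copies of $sl_2$; (b) $I=I_{1,1}\oplus I_{1,2}$, where $I_{1,1},I_{1,2}$ are irreducible $sl_2^1$-modules with $\dim I_{1,1}=\dim I_{1,2}=m+1$; (c) $I=I_{2,1}\oplus I_{2,2}\oplus\dots\oplus I_{2,m+1}$, where $I_{2,k}$ is an irreducible $sl_2^2$-module for each $1\le k\le m+1$. Then $L$ is isomorphic to the algebra with basis $\{e_1,f_1,h_1,e_2,f_2,h_2,x_0^1,\dots,x_m^1,x_0^2,\dots,x_m^2\}$ and the following table of multiplication, where $1\le i\le 2$ and $0\le j\le m$ (omitted products are zero): $$\begin{array}{ll} [e_i,h_i]=-[h_i,e_i]=2e_i, & \\ [e_i,f_i]=-[f_i,e_i]=h_i, & \\ [h_i,f_i]=-[f_i,h_i]=2f_i, & \\ [x_k^i,h_1]=(m-2k)x_k^i, & 0\le k\le m,\\ [x_k^i,f_1]=x_{k+1}^i, & 0\le k\le m-1,\\ [x_k^i,e_1]=-k(m+1-k)x_{k-1}^i, & 1\le k\le m,\\ [x_j^1,e_2]=[x_j^2,h_2]=x_j^2, & \\ [x_j^1,h_2]=[x_j^2,f_2]=-x_j^1. & \end{array}$$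
   Context: All vector spaces and algebras are finite-dimensional over $\mathbb{C}$. A (right) Leibniz algebra is an algebra $(L,[\cdot,\cdot])$ satisfying $[x,[y,z]]=[[x,y],z]-[[x,z],y]$ for all $x,y,z\in L$. The quotient $L/I$ is a Lie algebra. Since right multiplication by elements of $I$ is zero, $I$ is a right $L/I$-module via $x\cdot\bar a=[x,a]$ ($x\in I$, $a\in L$), and hence a right module over $sl_2^1$ and over $sl_2^2$. An irreducible module is a non-zero module whose only submodules are itself and zero. Superscripts on $x_k^i$ and on $sl_2^i$ are indices, not powers. *)

theory Defs
  imports "HOL-Analysis.Analysis" "HOL-Library.Poly_Mapping" "HOL-Library.Set_Algebras"
begin

section \<open>Complex algebras with explicit carrier\<close>

record 'a calg =
  carrier :: "'a set"
  vadd :: "'a \<Rightarrow> 'a \<Rightarrow> 'a"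
  vscale :: "complex \<Rightarrow> 'a \<Rightarrow> 'a"
  bracket :: "'a \<Rightarrow> 'a \<Rightarrow> 'a"

definition calg_iso :: "('a \<Rightarrow> 'b) \<Rightarrow> 'a calg \<Rightarrow> 'b calg \<Rightarrow> bool" where
  "calg_iso f A B \<longleftrightarrow> bij_betw f (carrier A) (carrier B) \<and>
     (\<forall>x\<in>carrier A. \<forall>y\<in>carrier A. f (vadd A x y) = vadd B (f x) (f y)) \<and>
     (\<forall>c. \<forall>x\<in>carrier A. f (vscale A c x) = vscale B c (f x)) \<and>
     (\<forall>x\<in>carrier A. \<forall>y\<in>carrier A. f (bracket A x y) = bracket B (f x) (f y))"

definition calg_isomorphic :: "'a calg \<Rightarrow> 'b calg \<Rightarrow> bool" where
  "calg_isomorphic A B \<longleftrightarrow> (\<exists>f. calg_iso f A B)"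

definition calg_prod :: "'a calg \<Rightarrow> 'b calg \<Rightarrow> ('a \<times> 'b) calg" where
  "calg_prod A B = \<lparr>
     carrier = carrier A \<times> carrier B,
     vadd = (\<lambda>p q. (vadd A (fst p) (fst q), vadd B (snd p) (snd q))),
     vscale = (\<lambda>c p. (vscale A c (fst p), vscale B c (snd p))),
     bracket = (\<lambda>p q. (bracket A (fst p) (fst q), bracket B (snd p) (snd q)))\<rparr>"

text \<open>In terms of the matrix units, the basis with \<open>[e,h] = 2e\<close>, \<open>[e,f] = h\<close>, \<open>[h,f] = 2f\<close> used for
  the table below is \<open>e = E12\<close>, \<open>f = -E21\<close>, \<open>h = E22 - E11\<close>.\<close>

definition sl2 :: "(complex^2^2) calg" where
  "sl2 = \<lparr>
     carrier = {A. trace A = 0},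
     vadd = (+),
     vscale = (\<lambda>c A. \<chi> i j. c * A $ i $ j),
     bracket = (\<lambda>A B. A ** B - B ** A)\<rparr>"


section \<open>Leibniz algebras\<close>

locale leibniz_algebra = vector_space scl
  for scl :: "complex \<Rightarrow> 'a::ab_group_add \<Rightarrow> 'a" +
  fixes br :: "'a \<Rightarrow> 'a \<Rightarrow> 'a"
  assumes finite_dimensional: "\<exists>B. finite B \<and> span B = UNIV"
    and linear_right: "Vector_Spaces.linear scl scl (\<lambda>y. br x y)"
    and linear_left: "Vector_Spaces.linear scl scl (\<lambda>x. br x y)"
    and leibniz: "br x (br y z) = br (br x y) z - br (br x z) y"

definition alg_of :: "(complex \<Rightarrow> 'a::ab_group_add \<Rightarrow> 'a) \<Rightarrow> ('a \<Rightarrow> 'a \<Rightarrow> 'a) \<Rightarrow> 'a calg" where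
  "alg_of scl br = \<lparr>carrier = UNIV, vadd = (+), vscale = scl, bracket = br\<rparr>"

definition is_ideal ::
  "(complex \<Rightarrow> 'a::ab_group_add \<Rightarrow> 'a) \<Rightarrow> ('a \<Rightarrow> 'a \<Rightarrow> 'a) \<Rightarrow> 'a set \<Rightarrow> bool" where
  "is_ideal scl br J \<longleftrightarrow>
     module.subspace scl J \<and> (\<forall>x\<in>J. \<forall>a. br x a \<in> J \<and> br a x \<in> J)"

definition squares_ideal ::
  "(complex \<Rightarrow> 'a::ab_group_add \<Rightarrow> 'a) \<Rightarrow> ('a \<Rightarrow> 'a \<Rightarrow> 'a) \<Rightarrow> 'a set" where
  "squares_ideal scl br = is_ideal scl br hull {br x x |x. True}"

text \<open>The elements of the quotient are the cosets \<open>x +o I\<close>; for an ideal \<open>I\<close> each of the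
  unions below is a single coset.\<close>

definition quotient_alg ::
  "(complex \<Rightarrow> 'a::ab_group_add \<Rightarrow> 'a) \<Rightarrow> ('a \<Rightarrow> 'a \<Rightarrow> 'a) \<Rightarrow> 'a set \<Rightarrow> 'a set calg" where
  "quotient_alg scl br I = \<lparr>
     carrier = range (\<lambda>x. x +o I),
     vadd = (\<lambda>X Y. \<Union>x\<in>X. \<Union>y\<in>Y. (x + y) +o I),
     vscale = (\<lambda>c X. \<Union>x\<in>X. scl c x +o I),
     bracket = (\<lambda>X Y. \<Union>x\<in>X. \<Union>y\<in>Y. br x y +o I)\<rparr>"


section \<open>Modules\<close>

definition right_module ::
  "(complex \<Rightarrow> 'a::ab_group_add \<Rightarrow> 'a) \<Rightarrow> 'g calg \<Rightarrow> ('a \<Rightarrow> 'g \<Rightarrow> 'a) \<Rightarrow> 'a set \<Rightarrow> bool" where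
  "right_module scl G act V \<longleftrightarrow> module.subspace scl V \<and>
     (\<forall>x\<in>V. \<forall>g\<in>carrier G. act x g \<in> V) \<and>
     (\<forall>x\<in>V. \<forall>y\<in>V. \<forall>g\<in>carrier G. act (x + y) g = act x g + act y g) \<and>
     (\<forall>c. \<forall>x\<in>V. \<forall>g\<in>carrier G. act (scl c x) g = scl c (act x g)) \<and>
     (\<forall>x\<in>V. \<forall>g\<in>carrier G. \<forall>h\<in>carrier G. act x (vadd G g h) = act x g + act x h) \<and>
     (\<forall>c. \<forall>x\<in>V. \<forall>g\<in>carrier G. act x (vscale G c g) = scl c (act x g)) \<and>
     (\<forall>x\<in>V. \<forall>g\<in>carrier G. \<forall>h\<in>carrier G.
        act x (bracket G g h) = act (act x g) h - act (act x h) g)"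

definition irreducible_module ::
  "(complex \<Rightarrow> 'a::ab_group_add \<Rightarrow> 'a) \<Rightarrow> 'g calg \<Rightarrow> ('a \<Rightarrow> 'g \<Rightarrow> 'a) \<Rightarrow> 'a set \<Rightarrow> bool" where
  "irreducible_module scl G act V \<longleftrightarrow> right_module scl G act V \<and> V \<noteq> {0} \<and>
     (\<forall>W\<subseteq>V. right_module scl G act W \<longrightarrow> W = {0} \<or> W = V)"

text \<open>\<open>I\<close> is the internal direct sum of the subspaces \<open>V j\<close>, \<open>j \<in> J\<close>, with \<open>J\<close> finite:
  the addition map from the external direct sum is a bijection onto \<open>I\<close>.\<close>

definition internal_direct_sum :: "'j set \<Rightarrow> ('j \<Rightarrow> 'a::ab_group_add set) \<Rightarrow> 'a set \<Rightarrow> bool" where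
  "internal_direct_sum J V I \<longleftrightarrow> bij_betw (\<lambda>v. \<Sum>j\<in>J. v j) (Pi\<^sub>E J V) I"

text \<open>The action \<open>x \<cdot> A = [x, a]\<close> of a coset \<open>A = a +o I\<close>. For \<open>x \<in> I\<close> the set \<open>br x ` A\<close> is a
  singleton, as right multiplication by elements of \<open>I\<close> vanishes.\<close>

definition quotient_act :: "('a \<Rightarrow> 'a \<Rightarrow> 'a) \<Rightarrow> 'a \<Rightarrow> 'a set \<Rightarrow> 'a" where
  "quotient_act br x A = the_elem (br x ` A)"

datatype copy = First | Second

fun inject :: "copy \<Rightarrow> complex^2^2 \<Rightarrow> (complex^2^2) \<times> (complex^2^2)" where
  "inject First s = (s, 0)"
| "inject Second s = (0, s)"

text \<open>The action on \<open>I\<close> of one of the two copies of \<open>sl2\<close>, where \<open>\<psi>\<close> identifies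
  \<open>calg_prod sl2 sl2\<close> with the quotient.\<close>

definition sl2_act ::
  "('a \<Rightarrow> 'a \<Rightarrow> 'a) \<Rightarrow> ((complex^2^2) \<times> (complex^2^2) \<Rightarrow> 'a set) \<Rightarrow> copy \<Rightarrow> 'a \<Rightarrow> complex^2^2 \<Rightarrow> 'a" where
  "sl2_act br \<psi> i x s = quotient_act br x (\<psi> (inject i s))"


section \<open>The algebra given by the multiplication table\<close>

text \<open>\<open>X i k\<close> is the basis vector $x_k^i$.\<close>

datatype gen = E copy | F copy | H copy | X copy nat

definition gens :: "nat \<Rightarrow> gen set" where
  "gens m = range E \<union> range F \<union> range H \<union> {X i k |i k. k \<le> m}"

fun table :: "nat \<Rightarrow> gen \<Rightarrow> gen \<Rightarrow> gen \<Rightarrow>\<^sub>0 complex" where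
  "table m (E i) (H j) = (if i = j then Poly_Mapping.single (E i) 2 else 0)"
| "table m (H i) (E j) = (if i = j then Poly_Mapping.single (E i) (- 2) else 0)"
| "table m (E i) (F j) = (if i = j then Poly_Mapping.single (H i) 1 else 0)"
| "table m (F i) (E j) = (if i = j then Poly_Mapping.single (H i) (- 1) else 0)"
| "table m (H i) (F j) = (if i = j then Poly_Mapping.single (F i) 2 else 0)"
| "table m (F i) (H j) = (if i = j then Poly_Mapping.single (F i) (- 2) else 0)"
| "table m (X i k) (H First) = Poly_Mapping.single (X i k) (of_nat m - 2 * of_nat k)"
| "table m (X i k) (F First) = (if k < m then Poly_Mapping.single (X i (k + 1)) 1 else 0)"
| "table m (X i k) (E First) =
     (if 1 \<le> k then Poly_Mapping.single (X i (k - 1)) (- (of_nat k * (of_nat m + 1 - of_nat k)))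
      else 0)"
| "table m (X First j) (E Second) = Poly_Mapping.single (X Second j) 1"
| "table m (X Second j) (H Second) = Poly_Mapping.single (X Second j) 1"
| "table m (X First j) (H Second) = Poly_Mapping.single (X First j) (- 1)"
| "table m (X Second j) (F Second) = Poly_Mapping.single (X First j) (- 1)"
| "table m _ _ = 0"

text \<open>The complex vector space with basis \<open>gens m\<close>, with \<open>table m\<close> extended bilinearly.\<close>

definition table_alg :: "nat \<Rightarrow> (gen \<Rightarrow>\<^sub>0 complex) calg" where
  "table_alg m = \<lparr>
     carrier = {p. Poly_Mapping.keys p \<subseteq> gens m},
     vadd = (+),
     vscale = (\<lambda>c p. Poly_Mapping.map ((*) c) p),
     bracket = (\<lambda>p q. \<Sum>a\<in>Poly_Mapping.keys p. \<Sum>b\<in>Poly_Mapping.keys q.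
        Poly_Mapping.map ((*) (Poly_Mapping.lookup p a * Poly_Mapping.lookup q b)) (table m a b))\<rparr>"

end

theory Submission
  imports Defs "HOL-Computational_Algebra.Fundamental_Theorem_Algebra"
begin

text \<open>Since \<open>[L, I] = 0\<close>, right multiplication makes \<open>L\<close> a right module over \<open>L/I\<close>, with \<open>I\<close> as a
  submodule. Over the first copy of \<open>sl2\<close> the ideal \<open>I\<close> is the tensor product of the irreducible
  module of dimension \<open>m + 1\<close> with a multiplicity plane, and the second copy acts on this plane. If
  that action were trivial, the \<open>m + 1\<close> irreducible summands in (c) would be lines, although
  \<open>dim I = 2 (m + 1)\<close>; so the plane is the standard module. The Casimir operator of the second copy
  therefore has no common eigenvalue on \<open>I\<close> and on \<open>L/I\<close>, which yields an equivariant complement of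
  \<open>I\<close>; being a submodule, it is a subalgebra isomorphic to \<open>L/I\<close>.\<close>

section \<open>Eigenvectors\<close>

text \<open>The Casimir operator of \<open>sl2\<close> is the scalar n (n + 2) on a module of
  highest weight n. The second copy has highest weight 1 on \<open>I\<close> and highest weights 0
  and 2 on the two summands of \<open>L/I\<close>, hence 3 against 0 and 8. The first copy cannot
  separate them uniformly in m: its scalar m (m + 2) on \<open>I\<close> is 0 for m = 0 and 8 for m
  = 2. A polynomial in the Casimir operator commutes with both copies, so an explicit formula for
  the projection takes the place of the theorems of Weyl and Levi; the only other instance of
  complete reducibility concerns a plane and is settled by hand. The complement is closed under
  products because the bracket is one-sided: [x, y] depends on x and on the class of y alone, so a
  product of two elements of the complement is a value of the module action. For the same reason the
  products of basis vectors of \<open>I\<close> with the complement are those with arbitrary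
  representatives.\<close>

context vector_space
begin

text \<open>Applying \<open>T - \<mu> j\<close> to the relation removes the term of the new index j
  and multiplies every other coefficient by the nonzero number
  \<open>\<mu> i - \<mu> j\<close>.\<close>

lemma eigenvectors_scalars_zero:
  assumes T: "Vector_Spaces.linear scale scale T" and "finite A"
    and "\<And>i. i \<in> A \<Longrightarrow> T (v i) = scale (\<mu> i) (v i)" "\<And>i. i \<in> A \<Longrightarrow> v i \<noteq> 0" "inj_on \<mu> A"
    and "(\<Sum>i\<in>A. scale (c i) (v i)) = 0" "i \<in> A"
  shows "c i = 0"
  using assms(2-)
proof (induction A arbitrary: c i rule: finite_induct)
  case empty
  then show ?case by simp
next
  case (insert j A)
  interpret T: Vector_Spaces.linear scale scale T by fact
  have s: "scale (c j) (v j) + (\<Sum>i\<in>A. scale (c i) (v i)) = 0"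
    using insert.hyps insert.prems(4) by simp
  have "(\<Sum>i\<in>A. scale (c i * (\<mu> i - \<mu> j)) (v i)) =
      T (\<Sum>i\<in>A. scale (c i) (v i)) - scale (\<mu> j) (\<Sum>i\<in>A. scale (c i) (v i))"
    using insert.prems(1)
    by (simp add: T.sum T.scale scale_sum_right sum_subtractf[symmetric] algebra_simps)
  also have "(\<Sum>i\<in>A. scale (c i) (v i)) = - scale (c j) (v j)"
    using s by (metis add_eq_0_iff)
  finally have "(\<Sum>i\<in>A. scale (c i * (\<mu> i - \<mu> j)) (v i)) = 0"
    using insert.prems(1)[of j] by (simp add: T.neg T.scale mult.commute)
  then have "c i * (\<mu> i - \<mu> j) = 0" if "i \<in> A" for i
    using insert.IH[of "\<lambda>i. c i * (\<mu> i - \<mu> j)" i] insert.prems(1-3) that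
    by (auto simp: inj_on_def)
  then have z: "c i = 0" if "i \<in> A" for i
    using that insert.prems(3) insert.hyps(2) by (auto simp: inj_on_def)
  then have "c j = 0"
    using s insert.prems(2)[of j] by simp
  with z insert.prems(5) show ?case by auto
qed

lemma eigenvectors_independent:
  assumes T: "Vector_Spaces.linear scale scale T" and "finite A"
    and ev: "\<And>i. i \<in> A \<Longrightarrow> T (v i) = scale (\<mu> i) (v i)" and nz: "\<And>i. i \<in> A \<Longrightarrow> v i \<noteq> 0"
    and inj: "inj_on \<mu> A"
  shows "inj_on v A" "independent (v ` A)"
proof -
  show injv: "inj_on v A"
  proof (rule inj_onI)
    fix i j assume ij: "i \<in> A" "j \<in> A" "v i = v j"
    then have "scale (\<mu> i) (v i) = scale (\<mu> j) (v i)"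
      by (metis ev)
    with nz[OF ij(1)] have "\<mu> i = \<mu> j" by (metis scale_right_imp_eq)
    with inj ij show "i = j" by (simp add: inj_on_def)
  qed
  show "independent (v ` A)"
  proof (rule independent_if_scalars_zero)
    fix c x assume s: "(\<Sum>x\<in>v ` A. scale (c x) x) = 0" and "x \<in> v ` A"
    then obtain i where i: "i \<in> A" "x = v i" by blast
    have "(\<Sum>i\<in>A. scale (c (v i)) (v i)) = 0"
      using s by (simp add: sum.reindex[OF injv])
    from eigenvectors_scalars_zero[OF T \<open>finite A\<close> ev nz inj this i(1)] i
    show "c x = 0" by simp
  qed (use \<open>finite A\<close> in simp)
qed

end

lemma (in vector_space) linear_funpow:
  assumes "Vector_Spaces.linear scale scale T"
  shows "Vector_Spaces.linear scale scale (T ^^ k)"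
  using assms by (induction k) (auto simp: Vector_Spaces.linear_iff)

context finite_dimensional_vector_space
begin

lemma eigenvalue_sequence_vanishes:
  assumes T: "Vector_Spaces.linear scale scale T"
    and ev: "\<And>k::nat. T (v k) = scale (\<mu> k) (v k)" and inj: "inj \<mu>"
  shows "\<exists>k. v k = 0"
proof (rule ccontr)
  assume "\<nexists>k. v k = 0"
  then have nz: "v k \<noteq> 0" for k by blast
  let ?A = "{..dimension}"
  have "inj_on v ?A" "independent (v ` ?A)"
    using eigenvectors_independent[OF T, of ?A v \<mu>] ev nz inj by (auto intro: inj_on_subset)
  then have "Suc dimension \<le> dim (v ` ?A)"
    using independent_card_le_dim[of "v ` ?A" "v ` ?A"] by (simp add: card_image)
  with dim_subset_UNIV show False
    by (metis not_less_eq_eq)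
qed

text \<open>The terms are indexed because the powers \<open>(T ^^ i) w\<close> to which this is
  applied may repeat. Two equal terms give the coefficients 1 and -1; otherwise a set of
  \<open>Suc dimension\<close> vectors is too large to be independent.\<close>

lemma dependent_sequence:
  shows "\<exists>c. (\<Sum>i\<le>dimension. scale (c i) (v i)) = 0 \<and> (\<exists>i\<le>dimension. c i \<noteq> 0)"
proof (cases "inj_on v {..dimension}")
  case False
  then obtain i j where ij: "i \<le> dimension" "j \<le> dimension" "i \<noteq> j" "v i = v j"
    by (auto simp: inj_on_def)
  define c where "c = (\<lambda>k. if k = i then 1 else if k = j then -1 else (0::'a))"
  have "(\<Sum>k\<le>dimension. scale (c k) (v k)) = (\<Sum>k\<in>{i, j}. scale (c k) (v k))"
    using ij by (intro sum.mono_neutral_right) (auto simp: c_def)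
  also have "\<dots> = 0"
    using ij by (simp add: c_def)
  finally show ?thesis
    using ij by (intro exI[of _ c]) (auto simp: c_def)
next
  case True
  then have "card (v ` {..dimension}) = Suc dimension"
    by (simp add: card_image)
  moreover have "card (v ` {..dimension}) \<le> dimension" if "independent (v ` {..dimension})"
    using independent_card_le_dim[OF order_refl that] dim_subset_UNIV order_trans by blast
  ultimately have "dependent (v ` {..dimension})"
    by fastforce
  then obtain c where c: "(\<Sum>x\<in>v ` {..dimension}. scale (c x) x) = 0"
    "\<exists>x\<in>v ` {..dimension}. c x \<noteq> 0"
    using dependent_finite[of "v ` {..dimension}"] by auto
  then show ?thesis
    by (intro exI[of _ "c \<circ> v"]) (auto simp: sum.reindex[OF True])
qed

end

section \<open>Existence of eigenvectors over the complex numbers\<close>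

locale complex_vector_space = finite_dimensional_vector_space scale Basis
  for scale :: "complex \<Rightarrow> 'v::ab_group_add \<Rightarrow> 'v" (infixr \<open>\<cdot>\<close> 75) and Basis
begin

text \<open>If p = (t - z) q, then u = q(T) w satisfies T u = z u. Either u is the eigenvector, or q
  annihilates w and has smaller degree. The bound N is kept apart from the degree so that one range
  of summation serves both p and q.\<close>

lemma polynomial_annihilator_eigenvector:
  assumes T: "Vector_Spaces.linear scale scale T" and V: "subspace V" "T ` V \<subseteq> V" "w \<in> V" "w \<noteq> 0"
    and p: "p \<noteq> 0" "degree p \<le> N" "(\<Sum>i\<le>N. coeff p i \<cdot> (T ^^ i) w) = 0"
  shows "\<exists>v\<in>V. \<exists>c. v \<noteq> 0 \<and> T v = c \<cdot> v"
  using p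
proof (induction "degree p" arbitrary: p N)
  case 0
  then obtain c where c: "p = [:c:]" by (metis degree_eq_zeroE)
  have "(\<Sum>i\<le>N. coeff p i \<cdot> (T ^^ i) w) = (\<Sum>i\<in>{0}. coeff p i \<cdot> (T ^^ i) w)"
    using 0 by (intro sum.mono_neutral_right) (auto simp: coeff_eq_0)
  with 0 c V(4) show ?case by simp
next
  case (Suc d)
  interpret T: Vector_Spaces.linear scale scale T by fact
  have "\<not> constant (poly p)"
    using Suc.hyps(2) by (simp add: constant_degree)
  then obtain z where "poly p z = 0"
    using fundamental_theorem_of_algebra by blast
  then obtain q where q: "p = [:- z, 1:] * q"
    by (metis poly_eq_0_iff_dvd dvdE)
  have q0: "q \<noteq> 0" using q Suc.prems by auto
  have dq: "degree p = Suc (degree q)"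
    unfolding q using q0 by (subst degree_mult_eq) auto
  obtain M where N: "N = Suc M" using dq Suc.prems by (cases N) auto
  define u where "u = (\<Sum>i\<le>N. coeff q i \<cdot> (T ^^ i) w)"
  have qN: "coeff q N = 0"
    using dq Suc.prems by (intro coeff_eq_0) simp
  have "0 = (\<Sum>i\<le>N. coeff (pCons 0 q) i \<cdot> (T ^^ i) w - z \<cdot> coeff q i \<cdot> (T ^^ i) w)"
    using Suc.prems(3) unfolding q by (simp add: scale_left_diff_distrib mult_pCons_left)
  also have "\<dots> = (\<Sum>i\<le>N. coeff (pCons 0 q) i \<cdot> (T ^^ i) w) - z \<cdot> u"
    by (simp only: u_def sum_subtractf scale_sum_right)
  also have "(\<Sum>i\<le>N. coeff (pCons 0 q) i \<cdot> (T ^^ i) w) = (\<Sum>i\<le>M. coeff q i \<cdot> (T ^^ Suc i) w)"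
    unfolding N by (subst sum.atMost_Suc_shift) simp
  also have "\<dots> = (\<Sum>i\<le>N. coeff q i \<cdot> (T ^^ Suc i) w)"
    using qN by (simp add: N)
  also have "\<dots> = T u"
    unfolding u_def by (simp add: T.sum T.scale)
  finally have Tu: "T u = z \<cdot> u" by simp
  show ?case
  proof (cases "u = 0")
    case True
    have "d = degree q" "degree q \<le> N" using Suc dq by auto
    from Suc.hyps(1)[OF this(1) q0 this(2)] True show ?thesis
      by (simp add: u_def)
  next
    case False
    have "(T ^^ i) w \<in> V" for i
      using V by (induction i) auto
    then have "u \<in> V"
      unfolding u_def using V by (intro subspace_sum subspace_scale) auto
    with Tu False show ?thesis by blast
  qed
qed

lemma eigenvector_exists:
  assumes T: "Vector_Spaces.linear scale scale T" and V: "subspace V" "T ` V \<subseteq> V" "V \<noteq> {0}"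
  shows "\<exists>v\<in>V. \<exists>c. v \<noteq> 0 \<and> T v = c \<cdot> v"
proof -
  obtain w where w: "w \<in> V" "w \<noteq> 0" using V subspace_0 by blast
  obtain c where c: "(\<Sum>i\<le>dimension. c i \<cdot> (T ^^ i) w) = 0" "\<exists>i\<le>dimension. c i \<noteq> 0"
    using dependent_sequence[of "\<lambda>i. (T ^^ i) w"] by auto
  define p where "p = (\<Sum>i\<le>dimension. monom (c i) i)"
  have p: "coeff p i = (if i \<le> dimension then c i else 0)" for i
    by (simp add: p_def coeff_sum)
  have "p \<noteq> 0" using c(2) p by (metis coeff_0)
  moreover have "degree p \<le> dimension"
    using p by (intro degree_le) auto
  moreover have "(\<Sum>i\<le>dimension. coeff p i \<cdot> (T ^^ i) w) = 0"
    using c(1) by (simp add: p)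
  ultimately show ?thesis
    using polynomial_annihilator_eigenvector[OF T V(1,2) w] by blast
qed

end

section \<open>Representations of sl2\<close>

text \<open>The operators are right actions: \<open>e v\<close> stands for \<open>v \<cdot> e\<close>, so the relation \<open>ef\<close> expresses
  \<open>[e, f] = h\<close>, and similarly for the other two.\<close>

locale sl2_triple = complex_vector_space scale Basis +
    e: Vector_Spaces.linear scale scale e +
    f: Vector_Spaces.linear scale scale f +
    h: Vector_Spaces.linear scale scale h
  for scale :: "complex \<Rightarrow> 'v::ab_group_add \<Rightarrow> 'v" (infixr \<open>\<cdot>\<close> 75) and Basis e f h +
  assumes ef: "f (e v) - e (f v) = h v"
    and eh: "h (e v) - e (h v) = 2 \<cdot> e v"
    and hf: "f (h v) - h (f v) = 2 \<cdot> f v"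
begin

lemma weight_raise:
  assumes "h v = c \<cdot> v"
  shows "h ((e ^^ k) v) = (c + 2 * of_nat k) \<cdot> (e ^^ k) v"
proof (induction k)
  case (Suc k)
  have "h (e ((e ^^ k) v)) = e (h ((e ^^ k) v)) + 2 \<cdot> e ((e ^^ k) v)"
    using eh[of "(e ^^ k) v"] by (simp add: algebra_simps)
  also have "e (h ((e ^^ k) v)) = (c + 2 * of_nat k) \<cdot> e ((e ^^ k) v)"
    by (simp only: Suc e.scale)
  finally show ?case by (simp add: algebra_simps)
qed (use assms in simp)

lemma weight_lower:
  assumes "h v = c \<cdot> v"
  shows "h ((f ^^ k) v) = (c - 2 * of_nat k) \<cdot> (f ^^ k) v"
proof (induction k)
  case (Suc k)
  have "h (f ((f ^^ k) v)) = f (h ((f ^^ k) v)) - 2 \<cdot> f ((f ^^ k) v)"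
    using hf[of "(f ^^ k) v"] by (simp add: algebra_simps)
  also have "f (h ((f ^^ k) v)) = (c - 2 * of_nat k) \<cdot> f ((f ^^ k) v)"
    by (simp only: Suc f.scale)
  finally show ?case by (simp add: algebra_simps)
qed (use assms in simp)

text \<open>Moving \<open>e\<close> past each \<open>f\<close> costs one \<open>h\<close>, with a
  minus sign since \<open>f e - e f = h\<close>. The weights c, c - 2, ..., c - 2k met on the way
  sum to (k + 1)(c - k).\<close>

lemma raise_lower:
  assumes "e v = 0" "h v = c \<cdot> v"
  shows "e ((f ^^ Suc k) v) = (- (of_nat (Suc k) * (c - of_nat k))) \<cdot> (f ^^ k) v"
proof (induction k)
  case 0
  show ?case using ef[of v] assms by (simp add: minus_equation_iff[of _ "c \<cdot> v"])
next
  case (Suc k)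
  let ?x = "(f ^^ Suc k) v"
  have "e (f ?x) = f (e ?x) - h ?x"
    using ef[of ?x] by (simp add: algebra_simps)
  also have "f (e ?x) = (- (of_nat (Suc k) * (c - of_nat k))) \<cdot> ?x"
    by (simp only: Suc f.scale) simp
  also have "h ?x = (c - 2 * of_nat (Suc k)) \<cdot> ?x"
    by (rule weight_lower) fact
  also have "(- (of_nat (Suc k) * (c - of_nat k))) \<cdot> ?x - (c - 2 * of_nat (Suc k)) \<cdot> ?x
      = (- (of_nat (Suc (Suc k)) * (c - of_nat (Suc k)))) \<cdot> ?x"
    unfolding scale_left_diff_distrib[symmetric]
    by (rule arg_cong[where f = "\<lambda>c. c \<cdot> ?x"]) (simp add: algebra_simps)
  finally show ?case by simp
qed

definition string :: "nat \<Rightarrow> 'v \<Rightarrow> bool" where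
  "string n v \<longleftrightarrow> e v = 0 \<and> h v = of_nat n \<cdot> v \<and> (f ^^ Suc n) v = 0"

lemma stringD:
  assumes "string n v"
  shows "e v = 0" "h v = of_nat n \<cdot> v" "(f ^^ Suc n) v = 0"
    "h ((f ^^ k) v) = (of_nat n - 2 * of_nat k) \<cdot> (f ^^ k) v"
    "e ((f ^^ Suc k) v) = (- (of_nat (Suc k) * (of_nat n - of_nat k))) \<cdot> (f ^^ k) v"
  using assms weight_lower[of v "of_nat n" k] raise_lower[of v "of_nat n" k]
  by (auto simp: string_def)

lemma string_scale: "string n v \<Longrightarrow> string n (c \<cdot> v)"
  and string_add: "string n v \<Longrightarrow> string n w \<Longrightarrow> string n (v + w)"
proof -
  have s: "(f ^^ k) (c \<cdot> v) = c \<cdot> (f ^^ k) v" and a: "(f ^^ k) (v + w) = (f ^^ k) v + (f ^^ k) w"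
    for k c v w
    by (induction k) (auto simp: f.scale f.add)
  show "string n v \<Longrightarrow> string n (c \<cdot> v)" "string n v \<Longrightarrow> string n w \<Longrightarrow> string n (v + w)"
    unfolding string_def s a by (auto simp: e.scale e.add h.scale h.add scale_right_distrib mult.commute)
qed

lemma string_nonzero:
  assumes "string n v" "v \<noteq> 0" "k \<le> n"
  shows "(f ^^ k) v \<noteq> 0"
  using \<open>k \<le> n\<close>
proof (induction k)
  case (Suc k)
  then have "(of_nat n - of_nat k :: complex) \<noteq> 0" by simp
  then have "e ((f ^^ Suc k) v) \<noteq> 0"
    unfolding stringD(5)[OF assms(1)] using Suc by (simp del: of_nat_Suc)
  then show ?case by (metis e.zero)
qed (use assms in simp)

text \<open>Together with \<open>raise_string_eq_0\<close>: \<open>e ^^ n\<close> returns the bottom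
  of a string to its top and kills the vectors above the bottom. On a sum of strings of equal length
  it therefore has the multiplicity space as image.\<close>

lemma raise_string:
  assumes "string n v" 
  shows "\<exists>c. c \<noteq> 0 \<and> (e ^^ n) ((f ^^ n) v) = c \<cdot> v"
proof -
  have *: "\<exists>c. c \<noteq> 0 \<and> (e ^^ k) ((f ^^ k) v) = c \<cdot> v" if "k \<le> n" for k
    using that
  proof (induction k)
    case 0
    then show ?case by (intro exI[of _ 1]) simp
  next
    case (Suc k)
    then obtain c where c: "c \<noteq> 0" "(e ^^ k) ((f ^^ k) v) = c \<cdot> v" by auto
    define d where "d = (- (of_nat (Suc k) * (of_nat n - of_nat k)) :: complex)"
    have "d \<noteq> 0" using Suc.prems by (simp add: d_def del: of_nat_Suc)
    have s: "(e ^^ k) (b \<cdot> w) = b \<cdot> (e ^^ k) w" for b w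
      by (induction k) (auto simp: e.scale)
    have "(e ^^ Suc k) ((f ^^ Suc k) v) = (e ^^ k) (e ((f ^^ Suc k) v))"
      by (simp only: funpow_Suc_right o_apply)
    also have "\<dots> = (d * c) \<cdot> v"
      unfolding stringD(5)[OF assms] d_def[symmetric] by (simp add: s c)
    finally show ?case using c \<open>d \<noteq> 0\<close> by (metis mult_eq_0_iff)
  qed
  show ?thesis by (rule *) simp
qed

lemma raise_string_eq_0:
  assumes "string n v" "k < j"
  shows "(e ^^ j) ((f ^^ k) v) = 0"
  using \<open>k < j\<close>
proof (induction j arbitrary: k)
  case (Suc j)
  have s: "(e ^^ j) (b \<cdot> w) = b \<cdot> (e ^^ j) w" "(e ^^ j) 0 = 0" for b w
    by (induction j) (auto simp: e.scale)
  have "(e ^^ Suc j) ((f ^^ k) v) = (e ^^ j) (e ((f ^^ k) v))"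
    by (simp only: funpow_Suc_right o_apply)
  also have "\<dots> = 0"
  proof (cases k)
    case 0
    then show ?thesis using stringD(1)[OF assms(1)] s by simp
  next
    case (Suc l)
    show ?thesis
      unfolding Suc stringD(5)[OF assms(1)] s(1) using Suc.IH[of l] Suc Suc.prems by simp
  qed
  finally show ?case .
qed simp

text \<open>Raising or lowering an eigenvector of \<open>h\<close> changes the eigenvalue by 2 at
  each step, so in finite dimension both processes reach zero.\<close>

lemma highest_weight_vector:
  assumes V: "subspace V" "V \<noteq> {0}" "e ` V \<subseteq> V" "h ` V \<subseteq> V"
  shows "\<exists>v\<in>V. \<exists>n. v \<noteq> 0 \<and> string n v"
proof -
  obtain w c where w: "w \<in> V" "w \<noteq> 0" "h w = c \<cdot> w"
    using eigenvector_exists[OF h.linear_axioms V(1,4,2)] by blast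
  have "inj (\<lambda>k::nat. c + 2 * of_nat k)"
    by (auto simp: inj_on_def)
  from eigenvalue_sequence_vanishes[OF h.linear_axioms weight_raise[OF w(3)] this]
  have ex: "\<exists>k. (e ^^ k) w = 0" .
  define k where "k = (LEAST k. (e ^^ k) w = 0)"
  have k: "(e ^^ k) w = 0" unfolding k_def by (rule LeastI_ex[OF ex])
  then obtain l where l: "k = Suc l" using w(2) by (cases k) auto
  define v where "v = (e ^^ l) w"
  have v0: "v \<noteq> 0"
    using not_less_Least[of l "\<lambda>k. (e ^^ k) w = 0"] l by (auto simp: v_def k_def)
  have ev: "e v = 0" using k l by (simp add: v_def)
  obtain d where d: "h v = d \<cdot> v" using weight_raise[OF w(3)] by (auto simp: v_def)
  have "(e ^^ l) w \<in> V" using w(1) V(3) by (induction l) auto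
  then have vV: "v \<in> V" by (simp add: v_def)
  have "inj (\<lambda>k::nat. d - 2 * of_nat k)"
    by (auto simp: inj_on_def)
  from eigenvalue_sequence_vanishes[OF h.linear_axioms weight_lower[OF d] this]
  have ex: "\<exists>k. (f ^^ k) v = 0" .
  define m where "m = (LEAST k. (f ^^ k) v = 0)"
  have m: "(f ^^ m) v = 0" unfolding m_def by (rule LeastI_ex[OF ex])
  then obtain n where n: "m = Suc n" using v0 by (cases m) auto
  have n0: "(f ^^ n) v \<noteq> 0"
    using not_less_Least[of n "\<lambda>k. (f ^^ k) v = 0"] n by (auto simp: m_def)
  \<comment> \<open>Where the lowered vectors first vanish, \<open>raise_lower\<close> multiplies
    the last nonzero one by zero; this forces the weight to be the natural number n.\<close>
  have "(of_nat (Suc n) * (d - of_nat n)) = 0"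
    using raise_lower[OF ev d, of n] m n0 unfolding n by (simp del: of_nat_Suc)
  then have "d = of_nat n" by (simp del: of_nat_Suc)
  then have "string n v"
    using ev d m n by (simp add: string_def)
  with vV v0 show ?thesis by blast
qed

lemma string_independent:
  assumes "string n v" "v \<noteq> 0"
  shows "inj_on (\<lambda>k. (f ^^ k) v) {..n}" "independent ((\<lambda>k. (f ^^ k) v) ` {..n})"
  using eigenvectors_independent[OF h.linear_axioms, of "{..n}" "\<lambda>k. (f ^^ k) v"
      "\<lambda>k. of_nat n - 2 * of_nat k"] stringD(4)[OF assms(1)] string_nonzero[OF assms]
  by (auto simp: inj_on_def)

text \<open>The vectors below a highest weight vector span a submodule, which must be all of
  \<open>V\<close>; counting dimensions then identifies the weight.\<close>

lemma irreducible_string: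
  assumes V: "subspace V" "V \<noteq> {0}" "e ` V \<subseteq> V" "f ` V \<subseteq> V" "h ` V \<subseteq> V"
    and irr: "\<And>W. subspace W \<Longrightarrow> W \<subseteq> V \<Longrightarrow> e ` W \<subseteq> W \<Longrightarrow> f ` W \<subseteq> W \<Longrightarrow> h ` W \<subseteq> W \<Longrightarrow> W = {0} \<or> W = V"
    and dim: "dim V = Suc n"
  shows "\<exists>v\<in>V. v \<noteq> 0 \<and> string n v \<and> V = span ((\<lambda>k. (f ^^ k) v) ` {..n})"
proof -
  obtain v m where v: "v \<in> V" "v \<noteq> 0" "string m v"
    using highest_weight_vector[OF V(1,2,3,5)] by blast
  let ?B = "(\<lambda>k. (f ^^ k) v) ` {..m}"
  have fV: "(f ^^ k) v \<in> V" for k using v(1) V(4) by (induction k) auto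
  have inv: "T ` span ?B \<subseteq> span ?B"
    if T: "Vector_Spaces.linear scale scale T" "\<And>k. k \<le> m \<Longrightarrow> T ((f ^^ k) v) \<in> span ?B" for T
  proof -
    interpret T: Vector_Spaces.linear scale scale T by fact
    have "T ` span ?B = span (T ` ?B)" by (simp only: T.span_image)
    also have "\<dots> \<subseteq> span ?B" using T(2) by (intro span_minimal) auto
    finally show ?thesis .
  qed
  have "h ` span ?B \<subseteq> span ?B"
    by (intro inv h.linear_axioms, unfold stringD(4)[OF v(3)]) (intro span_scale span_base, auto)
  moreover have "f ` span ?B \<subseteq> span ?B"
  proof (intro inv f.linear_axioms)
    fix k assume "k \<le> m"
    then show "f ((f ^^ k) v) \<in> span ?B"
      using stringD(3)[OF v(3)] 
      by (cases "k = m") (auto intro!: span_base span_zero image_eqI[of _ _ "Suc k"])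
  qed
  moreover have "e ` span ?B \<subseteq> span ?B"
  proof (intro inv e.linear_axioms)
    fix k assume "k \<le> m"
    show "e ((f ^^ k) v) \<in> span ?B"
    proof (cases k)
      case 0
      then show ?thesis using stringD(1)[OF v(3)] by (simp add: span_zero)
    next
      case (Suc l)
      with \<open>k \<le> m\<close> show ?thesis
        unfolding Suc stringD(5)[OF v(3)] by (intro span_scale span_base) auto
    qed
  qed
  moreover have sub: "span ?B \<subseteq> V" using fV V(1) by (intro span_minimal) auto
  moreover have "v \<in> span ?B" by (intro span_base image_eqI[of _ _ 0]) auto
  then have "span ?B \<noteq> {0}" using v(2) by auto
  ultimately have VB: "V = span ?B"
    using irr[of "span ?B"] by auto
  then have "Suc n = Suc m"
    using dim string_independent[OF v(3,2)] by (simp add: dim_eq_card_independent card_image)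
  with v VB show ?thesis by auto
qed

text \<open>The familiar form h^2 + 2 e f + 2 f e has its signs changed because \<open>- f\<close>
  is the lowering operator of a standard triple here.\<close>

definition casimir :: "'v \<Rightarrow> 'v" where
  "casimir v = h (h v) - 2 \<cdot> f (e v) - 2 \<cdot> e (f v)"

lemma casimir_linear: "Vector_Spaces.linear scale scale casimir"
  unfolding Vector_Spaces.linear_iff casimir_def using vector_space_axioms
  by (simp add: e.add e.scale f.add f.scale h.add h.scale scale_right_distrib
      scale_right_diff_distrib mult.commute)

lemma casimir_commute:
  "casimir (e v) = e (casimir v)" "casimir (f v) = f (casimir v)" "casimir (h v) = h (casimir v)"
proof -
  \<comment> \<open>Read from left to right, these relations bring every word into the order e, h,
    f, and both sides acquire the same normal form.\<close>
  have he: "h (e x) = e (h x) + 2 \<cdot> e x" and fe: "f (e x) = e (f x) + h x"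
    and fh: "f (h x) = h (f x) + 2 \<cdot> f x" for x
    using eh[of x] ef[of x] hf[of x] by (simp_all add: algebra_simps)
  have four: "4 \<cdot> x = 2 \<cdot> x + 2 \<cdot> x" for x
    by (simp flip: scale_left_distrib)
  note rules = casimir_def he fe fh e.add e.diff e.scale f.add f.diff f.scale h.add h.diff h.scale
  show "casimir (e v) = e (casimir v)"
    by (simp add: rules four algebra_simps)
  show "casimir (f v) = f (casimir v)"
    by (simp add: rules four algebra_simps)
  show "casimir (h v) = h (casimir v)"
    by (simp add: rules four algebra_simps)
qed

end

section \<open>Two commuting triples and the multiplicity plane\<close>

locale commuting_sl2_triples = complex_vector_space scale Basis +
    s1: sl2_triple scale Basis e1 f1 h1 + s2: sl2_triple scale Basis e2 f2 h2
  for scale :: "complex \<Rightarrow> 'v::ab_group_add \<Rightarrow> 'v" (infixr \<open>\<cdot>\<close> 75) and Basis e1 f1 h1 e2 f2 h2 +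
  assumes commute: "a \<in> {e1, f1, h1} \<Longrightarrow> b \<in> {e2, f2, h2} \<Longrightarrow> a (b v) = b (a v)"
begin

abbreviation orbit :: "nat \<Rightarrow> 'v \<Rightarrow> 'v set" where
  "orbit m v \<equiv> (\<lambda>k. (f1 ^^ k) v) ` {..m}"

lemma funpow_commute:
  assumes "a \<in> {e1, f1, h1}" "b \<in> {e2, f2, h2}"
  shows "(a ^^ k) (b v) = b ((a ^^ k) v)"
  by (induction k) (simp_all add: commute[OF assms])

lemma second_linear: "b \<in> {e2, f2, h2} \<Longrightarrow> Vector_Spaces.linear scale scale b"
  using s2.e.linear_axioms s2.f.linear_axioms s2.h.linear_axioms by blast

lemma span_invariant:
  assumes "Vector_Spaces.linear scale scale T" "\<And>x. x \<in> B \<Longrightarrow> T x \<in> span C"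
  shows "T ` span B \<subseteq> span C"
proof -
  interpret T: Vector_Spaces.linear scale scale T by fact
  show ?thesis
    unfolding T.span_image[symmetric] using assms(2) by (intro span_minimal) auto
qed

text \<open>Modulo \<open>v\<close> the operators act on \<open>u\<close> by scalars, which commute,
  so the relations force \<open>\<alpha>\<close> and \<open>\<phi>\<close> to vanish. Now
  \<open>u\<close> is sent into the line of \<open>v\<close>, which is killed; being multiples of
  commutators, the operators vanish on \<open>u\<close>.\<close>

lemma trivial_on_plane:
  assumes v: "e2 v = 0" "f2 v = 0" "h2 v = 0"
    and u: "e2 u \<in> span {u, v}" "f2 u \<in> span {u, v}"
  shows "e2 u = 0 \<and> f2 u = 0 \<and> h2 u = 0"
proof (cases "u \<in> span {v}")
  case True
  then show ?thesis
    using v by (auto simp: span_singleton s2.e.scale s2.f.scale s2.h.scale)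
next
  case False
  have comb: "\<exists>\<alpha> \<beta>. x = \<alpha> \<cdot> u + \<beta> \<cdot> v" if "x \<in> span {u, v}" for x
  proof -
    from that obtain \<alpha> where "x - \<alpha> \<cdot> u \<in> span {v}" by (auto simp: span_breakdown_eq)
    then obtain \<beta> where "x - \<alpha> \<cdot> u = \<beta> \<cdot> v" by (auto simp: span_singleton)
    then show ?thesis by (metis add.commute diff_add_cancel)
  qed
  have uniq: "\<alpha> = 0" if "\<alpha> \<cdot> u = \<beta> \<cdot> v" for \<alpha> \<beta>
  proof (rule ccontr)
    assume "\<alpha> \<noteq> 0"
    then have "u = inverse \<alpha> \<cdot> \<alpha> \<cdot> u" by simp
    also have "\<dots> = (inverse \<alpha> * \<beta>) \<cdot> v" by (simp add: that)
    finally show False using False by (metis span_base span_scale insertI1)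
  qed
  obtain \<alpha> \<beta> where e: "e2 u = \<alpha> \<cdot> u + \<beta> \<cdot> v" using comb u(1) by blast
  obtain \<phi> \<epsilon> where f: "f2 u = \<phi> \<cdot> u + \<epsilon> \<cdot> v" using comb u(2) by blast
  have h: "h2 u = \<alpha> \<cdot> (\<phi> \<cdot> u + \<epsilon> \<cdot> v) - \<phi> \<cdot> (\<alpha> \<cdot> u + \<beta> \<cdot> v)"
    using s2.ef[of u] by (simp add: e f s2.e.add s2.e.scale s2.f.add s2.f.scale v)
  then have h': "h2 u = (\<alpha> * \<epsilon> - \<phi> * \<beta>) \<cdot> v"
    by (simp add: algebra_simps)
  define \<delta> where "\<delta> = \<alpha> * \<epsilon> - \<phi> * \<beta>"
  have "\<alpha> \<cdot> \<delta> \<cdot> v = 2 \<cdot> (\<alpha> \<cdot> u + \<beta> \<cdot> v)"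
    using s2.eh[of u] by (simp add: e h' \<delta>_def[symmetric] s2.e.add s2.e.scale s2.h.add s2.h.scale v)
  then have "(2 * \<alpha>) \<cdot> u = (\<alpha> * \<delta> - 2 * \<beta>) \<cdot> v"
    by (simp add: algebra_simps)
  then have \<alpha>: "\<alpha> = 0" using uniq by fastforce
  have "- (\<phi> \<cdot> \<delta> \<cdot> v) = 2 \<cdot> (\<phi> \<cdot> u + \<epsilon> \<cdot> v)"
    using s2.hf[of u] by (simp add: f h' \<delta>_def[symmetric] s2.f.add s2.f.scale s2.h.add s2.h.scale v)
  then have "(2 * \<phi>) \<cdot> u = (- \<phi> * \<delta> - 2 * \<epsilon>) \<cdot> v"
    by (simp add: algebra_simps)
  then have \<phi>: "\<phi> = 0" using uniq by fastforce
  have h0: "h2 u = 0" using h \<alpha> \<phi> by simp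
  have "2 \<cdot> e2 u = 0" using s2.eh[of u] h0 e \<alpha> v by (simp add: s2.h.scale)
  moreover have "2 \<cdot> f2 u = 0" using s2.hf[of u] h0 f \<phi> v by (simp add: s2.h.scale)
  ultimately show ?thesis using h0 by simp
qed

lemma plane_exchange:
  assumes "v \<in> span {y, z}" "v \<noteq> 0"
  shows "\<exists>u\<in>{y, z}. span {y, z} \<subseteq> span {u, v}"
proof (cases "v \<in> span {z}")
  case True
  then have "z \<in> span {v}"
    using in_span_insert[of v z "{}"] assms(2) by auto
  then have "span {y, z} \<subseteq> span {y, v}"
    using span_mono[of "{v}" "{y, v}"] span_base[of y "{y, v}"] by (intro span_minimal) auto
  then show ?thesis by blast
next
  case False
  then have "y \<in> span {v, z}"
    using in_span_insert[of v y "{z}"] assms(1) by auto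
  then have "span {y, z} \<subseteq> span {z, v}"
    using span_base[of z "{z, v}"] by (intro span_minimal) (auto simp: insert_commute)
  then show ?thesis by blast
qed

text \<open>The multiplicity space of the first triple is the plane spanned by \<open>y\<close> and \<open>z\<close>. It is also
  the image of \<open>U\<close> under \<open>e1 ^^ m\<close>, so the second triple acts on it.\<close>

lemma standard_pair:
  assumes U: "subspace U" "f1 ` U \<subseteq> U" "e2 ` U \<subseteq> U" "f2 ` U \<subseteq> U" "h2 ` U \<subseteq> U"
    and yz: "s1.string m y" "s1.string m z" "U = span (orbit m y \<union> orbit m z)"
    and nontriv: "\<exists>u\<in>U. e2 u \<noteq> 0 \<or> f2 u \<noteq> 0 \<or> h2 u \<noteq> 0"
  shows "\<exists>p\<in>U. \<exists>q\<in>U. p \<noteq> 0 \<and> q \<noteq> 0 \<and> s1.string m p \<and> s1.string m q \<and>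
     e2 p = q \<and> h2 p = - p \<and> f2 p = 0 \<and> e2 q = 0 \<and> h2 q = q \<and> f2 q = - p \<and>
     U = span (orbit m p \<union> orbit m q)"
proof -
  define W where "W = span {y, z}"
  have W: "subspace W" by (simp add: W_def)
  have yW: "y \<in> W" "z \<in> W" by (simp_all add: W_def span_base)
  have fU: "(f1 ^^ k) x \<in> U" if "x \<in> U" for k x
    using that U(2) by (induction k) auto
  have yU: "y \<in> U" "z \<in> U"
    unfolding yz(3) by (intro span_base UnI1 UnI2 image_eqI[of _ _ 0]; simp)+
  have WU: "W \<subseteq> U" unfolding W_def using yU U(1) by (intro span_minimal) auto
  have eW: "(e1 ^^ m) ` U \<subseteq> W"
    unfolding yz(3) W_def
  proof (rule span_invariant[OF linear_funpow[OF s1.e.linear_axioms]])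
    fix x assume "x \<in> orbit m y \<union> orbit m z"
    then obtain w k where w: "w \<in> {y, z}" "k \<le> m" "x = (f1 ^^ k) w" by auto
    have sw: "s1.string m w" using w(1) yz by auto
    show "(e1 ^^ m) x \<in> span {y, z}"
    proof (cases "k = m")
      case True
      obtain c where "(e1 ^^ m) x = c \<cdot> w"
        using s1.raise_string[OF sw] w(3) True by blast
      then show ?thesis using w(1) by (simp add: span_scale span_base)
    next
      case False
      then show ?thesis
        using s1.raise_string_eq_0[OF sw, of k m] w span_zero by auto
    qed
  qed
  \<comment> \<open>Up to a nonzero factor, \<open>w\<close> is \<open>e1 ^^ m\<close> of a vector
    of \<open>U\<close>. As \<open>b\<close> preserves \<open>U\<close> and commutes with
    \<open>e1\<close>, the vector \<open>b w\<close> is again in the image.\<close>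
  have bW: "b ` W \<subseteq> W" if b: "b \<in> {e2, f2, h2}" for b
    unfolding W_def
  proof (rule span_invariant[OF second_linear[OF b]])
    fix w assume w: "w \<in> {y, z}"
    interpret b: Vector_Spaces.linear scale scale b by (rule second_linear) fact
    have sw: "s1.string m w" using w(1) yz by auto
    then obtain c where c: "c \<noteq> 0" "(e1 ^^ m) ((f1 ^^ m) w) = c \<cdot> w"
      using s1.raise_string by blast
    have "b ((f1 ^^ m) w) \<in> U"
      using fU[of w m] b U w yU by auto
    then have "(e1 ^^ m) (b ((f1 ^^ m) w)) \<in> W" using eW by blast
    then have "b (c \<cdot> w) \<in> W"
      using funpow_commute[of e1 b m] b c(2) by simp
    then have "inverse c \<cdot> c \<cdot> b w \<in> W"
      using W by (metis b.scale subspace_scale)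
    with c(1) show "b w \<in> span {y, z}" by (simp add: W_def)
  qed
  have sW: "s1.string m w" if "w \<in> W" for w
    using that unfolding W_def
  proof (induction rule: span_induct_alt)
    case base
    show ?case using s1.string_scale[OF yz(1), of 0] by simp
  next
    case (step c x y)
    then show ?case using yz by (intro s1.string_add s1.string_scale) auto
  qed
  \<comment> \<open>Since \<open>b\<close> commutes with \<open>f1\<close>, its vanishing at the
    tops of the two strings spreads to all of \<open>U\<close>.\<close>
  have zero: "b u = 0" if b: "b \<in> {e2, f2, h2}" and "b y = 0" "b z = 0" "u \<in> U" for b u
  proof -
    interpret b: Vector_Spaces.linear scale scale b by (rule second_linear) fact
    interpret fk: Vector_Spaces.linear scale scale "f1 ^^ k" for k
      by (rule linear_funpow) (rule s1.f.linear_axioms)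
    have "b x = 0" if "x \<in> orbit m y \<union> orbit m z" for x
      using that funpow_commute[of f1 b _ y] funpow_commute[of f1 b _ z] b \<open>b y = 0\<close> \<open>b z = 0\<close>
      by (auto simp: fk.zero)
    then show ?thesis
      using b.eq_0_on_span[of "orbit m y \<union> orbit m z"] \<open>u \<in> U\<close> unfolding yz(3) by blast
  qed
  have "W \<noteq> {0}"
  proof
    assume "W = {0}"
    with yW have "y = 0" "z = 0" by auto
    then have "e2 u = 0" "f2 u = 0" "h2 u = 0" if "u \<in> U" for u
      using zero[of e2 u] zero[of f2 u] zero[of h2 u] that by simp_all
    with nontriv show False by blast
  qed
  then obtain v n where v: "v \<in> W" "v \<noteq> 0" "s2.string n v"
    using s2.highest_weight_vector[OF W _ bW bW] by auto
  note sv = s2.stringD[OF v(3)]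
  note ind = s2.string_independent[OF v(3,2)]
  have f2W: "(f2 ^^ k) v \<in> W" for k using v(1) bW[of f2] by (induction k) auto
  have "card ((\<lambda>k. (f2 ^^ k) v) ` {..n}) \<le> card {y, z}"
    using independent_span_bound[OF _ ind(2), of "{y, z}"] f2W by (auto simp: W_def)
  also have "\<dots> \<le> 2" by (simp add: card_insert_if)
  finally have "n \<le> 1" by (simp add: card_image[OF ind(1)])
  \<comment> \<open>A highest weight vector of weight 0 would make the plane, and then all of
    \<open>U\<close>, trivial for the second triple.\<close>
  moreover have "n \<noteq> 0"
  proof
    assume "n = 0"
    then have tv: "e2 v = 0" "f2 v = 0" "h2 v = 0" using sv by auto
    obtain u where u: "u \<in> {y, z}" "W \<subseteq> span {u, v}"
      using plane_exchange v(1,2) unfolding W_def by blast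
    have "u \<in> W" using u(1) yW by blast
    then have "e2 u = 0 \<and> f2 u = 0 \<and> h2 u = 0"
      using trivial_on_plane[OF tv, of u] bW[of e2] bW[of f2] u(2) by auto
    then have "b w = 0" if b: "b \<in> {e2, f2, h2}" and "w \<in> {y, z}" for b w
    proof -
      interpret b: Vector_Spaces.linear scale scale b by (rule second_linear) fact
      have "w \<in> span {u, v}"
        using u(2) \<open>w \<in> {y, z}\<close> yW by blast
      then show ?thesis
        using b.eq_0_on_span[of "{u, v}" w] b \<open>e2 u = 0 \<and> f2 u = 0 \<and> h2 u = 0\<close> tv by auto
    qed
    then have "e2 u = 0" "f2 u = 0" "h2 u = 0" if "u \<in> U" for u
      using zero[of e2 u] zero[of f2 u] zero[of h2 u] that by simp_all
    with nontriv show False by blast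
  qed
  ultimately have n: "n = 1" by simp
  \<comment> \<open>The vector \<open>v\<close> has weight 1, so \<open>e2 (f2 v) = - v\<close>; the
    sign in \<open>p\<close> makes \<open>e2 p = v\<close>, as in the table.\<close>
  define p where "p = - f2 v"
  have pW: "p \<in> W" unfolding p_def using f2W[of 1] W by (simp add: subspace_neg)
  have p0: "p \<noteq> 0" using s2.string_nonzero[OF v(3,2), of 1] n by (simp add: p_def)
  have rel: "e2 p = v" "h2 p = - p" "f2 p = 0" "e2 v = 0" "h2 v = v" "f2 v = - p"
    using sv(1-3) sv(4)[of 1] sv(5)[of 0] n
    by (auto simp: p_def s2.e.neg s2.f.neg s2.h.neg)
  have "W \<subseteq> span ((\<lambda>k. (f2 ^^ k) v) ` {..n})"
  proof (rule card_ge_dim_independent[OF _ ind(2)])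
    show "(\<lambda>k. (f2 ^^ k) v) ` {..n} \<subseteq> W" using f2W by auto
    have "dim W \<le> card {y, z}" unfolding W_def by (intro dim_le_card) auto
    also have "\<dots> \<le> 2" by (simp add: card_insert_if)
    finally show "dim W \<le> card ((\<lambda>k. (f2 ^^ k) v) ` {..n})"
      unfolding card_image[OF ind(1)] by (simp add: n)
  qed
  also have "\<dots> \<subseteq> span {p, v}"
  proof (rule span_minimal)
    have "f2 v \<in> span {p, v}" unfolding rel(6) by (intro span_neg span_base) simp
    then show "(\<lambda>k. (f2 ^^ k) v) ` {..n} \<subseteq> span {p, v}"
      using span_base[of v "{p, v}"] by (auto simp: n le_Suc_eq)
  qed simp
  finally have Wpv: "W \<subseteq> span {p, v}" .
  have orb: "(f1 ^^ k) w \<in> span (orbit m p \<union> orbit m v)" if "w \<in> W" "k \<le> m" for w k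
  proof -
    have "(f1 ^^ k) ` span {p, v} \<subseteq> span (orbit m p \<union> orbit m v)"
      using that(2) by (intro span_invariant linear_funpow s1.f.linear_axioms) (auto intro!: span_base)
    with that(1) Wpv show ?thesis by blast
  qed
  have "U \<subseteq> span (orbit m p \<union> orbit m v)"
    unfolding yz(3) using orb yW by (intro span_minimal) auto
  moreover have "span (orbit m p \<union> orbit m v) \<subseteq> U"
    using fU WU pW v(1) U(1) by (intro span_minimal) auto
  ultimately show ?thesis
    using p0 v rel pW WU sW by blast
qed

end

section \<open>Leibniz algebras and their quotients\<close>

context leibniz_algebra
begin

lemma br_add_left: "br (x + y) z = br x z + br y z"
  and br_scale_left: "br (scl c x) z = scl c (br x z)"
  and br_add_right: "br z (x + y) = br z x + br z y"
  and br_scale_right: "br z (scl c x) = scl c (br z x)"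
  using linear_left[of z] linear_right[of z] by (auto simp: Vector_Spaces.linear_iff)

lemma br_zero: "br 0 z = 0" "br z 0 = 0"
  using br_scale_left[of 0 0 z] br_scale_right[of z 0 0] by simp_all

lemma br_diff_left: "br (x - y) z = br x z - br y z"
  and br_diff_right: "br z (x - y) = br z x - br z y"
  using br_add_left[of "x - y" y z] br_add_right[of z "x - y" y] by (simp_all add: algebra_simps)

lemma br_sum_left: "br (sum g A) z = (\<Sum>i\<in>A. br (g i) z)"
  and br_sum_right: "br z (sum g A) = (\<Sum>i\<in>A. br z (g i))"
  by (induction A rule: infinite_finite_induct) (auto simp: br_zero br_add_left br_add_right)

lemma squares_ideal_is_ideal: "is_ideal scl br (squares_ideal scl br)"
  unfolding squares_ideal_def
  by (rule hull_in) (auto simp: is_ideal_def intro!: subspace_Inter)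

text \<open>By the Leibniz identity the elements \<open>u\<close> with [a, u] = 0 for all a form an
  ideal. It contains the squares, since the identity for [a, [x, x]] subtracts a term from
  itself.\<close>

lemma squares_ideal_annihilates:
  assumes "u \<in> squares_ideal scl br"
  shows "br a u = 0"
proof -
  let ?Z = "{u. \<forall>a. br a u = 0}"
  have "is_ideal scl br ?Z"
    unfolding is_ideal_def
    by (auto intro!: subspaceI simp: br_add_right br_scale_right br_zero leibniz)
  moreover have "{br x x |x. True} \<subseteq> ?Z" by (auto simp: leibniz)
  ultimately have "squares_ideal scl br \<subseteq> ?Z"
    unfolding squares_ideal_def by (intro hull_minimal)
  with assms show ?thesis by blast
qed

end

lemma (in module) coset_eq_iff:
  assumes "subspace J"
  shows "x +o J = y +o J \<longleftrightarrow> x - y \<in> J"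
proof
  assume "x +o J = y +o J"
  moreover have "x \<in> x +o J" using subspace_0[OF assms] by (auto simp: elt_set_plus_def)
  ultimately obtain j where "j \<in> J" "x = y + j" by (auto simp: elt_set_plus_def)
  then show "x - y \<in> J" by simp
next
  have sub: "x +o J \<subseteq> y +o J" if "x - y \<in> J" for x y
  proof
    fix a assume "a \<in> x +o J"
    then obtain j where "j \<in> J" "a = x + j" by (auto simp: elt_set_plus_def)
    then have "a = y + ((x - y) + j)" "(x - y) + j \<in> J"
      using that assms by (auto intro: subspace_add)
    then show "a \<in> y +o J" unfolding elt_set_plus_def by blast
  qed
  assume "x - y \<in> J"
  moreover from this have "y - x \<in> J" using subspace_neg[OF assms] by fastforce
  ultimately show "x +o J = y +o J" using sub by blast
qed

lemma UN_const_on: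
  assumes "x \<in> A" "\<And>y. y \<in> A \<Longrightarrow> g y = B"
  shows "(\<Union>y\<in>A. g y) = B"
  using assms by blast

lemma (in leibniz_algebra) quotient_alg_simps:
  assumes "is_ideal scl br J"
  shows "vadd (quotient_alg scl br J) (x +o J) (y +o J) = (x + y) +o J"
    and "vscale (quotient_alg scl br J) c (x +o J) = scl c x +o J"
    and "bracket (quotient_alg scl br J) (x +o J) (y +o J) = br x y +o J"
proof -
  have J: "subspace J" and br_J: "\<And>u a. u \<in> J \<Longrightarrow> br u a \<in> J" "\<And>u a. u \<in> J \<Longrightarrow> br a u \<in> J"
    using assms by (auto simp: is_ideal_def)
  have self: "x \<in> x +o J" for x using subspace_0[OF J] by (auto simp: elt_set_plus_def)
  have mem: "a \<in> x +o J \<Longrightarrow> a - x \<in> J" for a x by (auto simp: elt_set_plus_def)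
  have add: "(a + b) +o J = (x + y) +o J" if "a \<in> x +o J" "b \<in> y +o J" for a b
    unfolding coset_eq_iff[OF J]
    using subspace_add[OF J mem[OF that(1)] mem[OF that(2)]] by (simp add: algebra_simps)
  have scale: "scl c a +o J = scl c x +o J" if "a \<in> x +o J" for a
    unfolding coset_eq_iff[OF J]
    using subspace_scale[OF J mem[OF that], of c] by (simp add: scale_right_diff_distrib)
  have brk: "br a b +o J = br x y +o J" if "a \<in> x +o J" "b \<in> y +o J" for a b
  proof -
    have "br a b - br x y = br (a - x) b + br x (b - y)"
      by (simp add: br_diff_left br_diff_right)
    then show ?thesis
      unfolding coset_eq_iff[OF J] using mem that br_J J by (simp add: subspace_add)
  qed
  show "vadd (quotient_alg scl br J) (x +o J) (y +o J) = (x + y) +o J"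
    unfolding quotient_alg_def calg.simps by (intro UN_const_on[OF self] add)
  show "vscale (quotient_alg scl br J) c (x +o J) = scl c x +o J"
    unfolding quotient_alg_def calg.simps by (intro UN_const_on[OF self] scale)
  show "bracket (quotient_alg scl br J) (x +o J) (y +o J) = br x y +o J"
    unfolding quotient_alg_def calg.simps by (intro UN_const_on[OF self] brk)
qed

lemma (in leibniz_algebra) quotient_act_coset:
  assumes "subspace J" "\<And>u. u \<in> J \<Longrightarrow> br x u = 0"
  shows "quotient_act br x (a +o J) = br x a"
proof -
  have "br x ` (a +o J) = {br x a}"
    using subspace_0[OF assms(1)] assms(2) by (auto simp: elt_set_plus_def br_add_right image_iff)
  then show ?thesis by (simp add: quotient_act_def)
qed

section \<open>Computations with traceless matrices\<close>

definition commutator :: "complex^2^2 \<Rightarrow> complex^2^2 \<Rightarrow> complex^2^2" where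
  "commutator A B = A ** B - B ** A"

definition entry_scale :: "complex \<Rightarrow> complex^2^2 \<Rightarrow> complex^2^2" where
  "entry_scale c A = (\<chi> i j. c * A $ i $ j)"

definition mat_e :: "complex^2^2" where "mat_e = vector [vector [0, 1], vector [0, 0]]"
definition mat_f :: "complex^2^2" where "mat_f = vector [vector [0, 0], vector [-1, 0]]"
definition mat_h :: "complex^2^2" where "mat_h = vector [vector [-1, 0], vector [0, 1]]"

lemmas mat2_simps = vec_eq_iff forall_2 sum_2 matrix_matrix_mult_def commutator_def entry_scale_def
  mat_e_def mat_f_def mat_h_def trace_def

lemma commutator_basis:
  "commutator mat_e mat_f = mat_h" "commutator mat_f mat_e = entry_scale (-1) mat_h"
  "commutator mat_e mat_h = entry_scale 2 mat_e" "commutator mat_h mat_e = entry_scale (-2) mat_e"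
  "commutator mat_h mat_f = entry_scale 2 mat_f" "commutator mat_f mat_h = entry_scale (-2) mat_f"
  "commutator A A = 0" "commutator A 0 = 0" "commutator 0 A = 0"
  by (simp_all add: mat2_simps)

lemma trace_basis: "trace mat_e = 0" "trace mat_f = 0" "trace mat_h = 0" "trace (0::complex^2^2) = 0"
  by (simp_all add: mat2_simps)

lemma traceless_decomposition:
  assumes "trace A = 0"
  shows "A = entry_scale (A $ 1 $ 2) mat_e + entry_scale (- (A $ 2 $ 1)) mat_f + entry_scale (A $ 2 $ 2) mat_h"
  using assms by (simp add: mat2_simps add_eq_0_iff)

lemma basis_combination_eq_0:
  assumes "entry_scale a mat_e + entry_scale b mat_f + entry_scale c mat_h = 0"
  shows "a = 0" "b = 0" "c = 0"
  using assms by (simp_all add: mat2_simps)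

text \<open>The adjoint module has highest weight 2, and 2 (2 + 2) = 8. Bracketing with
  \<open>mat_e\<close> and then \<open>mat_f\<close> is the composite f e of right actions.\<close>

lemma adjoint_casimir:
  assumes "trace A = 0"
  shows "commutator (commutator A mat_h) mat_h - entry_scale 2 (commutator (commutator A mat_e) mat_f)
     - entry_scale 2 (commutator (commutator A mat_f) mat_e) = entry_scale 8 A"
  using assms by (simp add: mat2_simps add_eq_0_iff)

section \<open>Leibniz algebras over a sum of two copies of sl2\<close>

lemma entry_scale_zero [simp]: "entry_scale c 0 = 0" "entry_scale 0 A = 0"
  by (simp_all add: entry_scale_def vec_eq_iff)

lemma entry_scale_uminus: "entry_scale (- c) A = - entry_scale c A"
  by (simp add: entry_scale_def vec_eq_iff)

lemma entry_scale_one [simp]: "entry_scale 1 A = A"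
  by (simp add: entry_scale_def vec_eq_iff)

fun gen_matrices :: "gen \<Rightarrow> (complex^2^2) \<times> (complex^2^2)" where
  "gen_matrices (E i) = inject i mat_e"
| "gen_matrices (F i) = inject i mat_f"
| "gen_matrices (H i) = inject i mat_h"
| "gen_matrices (X i k) = 0"

lemma fst_snd_inject:
  "fst (inject i A) = (if i = First then A else 0)" "snd (inject i A) = (if i = Second then A else 0)"
  by (cases i; simp)+

definition sl2_gens :: "gen set" where
  "sl2_gens = range E \<union> range F \<union> range H"

text \<open>The quotient enters as a surjection onto pairs of traceless matrices, which frees the
  argument from cosets; the kernel of \<open>q\<close> takes the role of \<open>I\<close>.\<close>

locale double_sl2_quotient = leibniz_algebra scl br + complex_vector_space scl Basis
  for scl :: "complex \<Rightarrow> 'v::ab_group_add \<Rightarrow> 'v" (infixr \<open>\<cdot>\<close> 75) and br Basis +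
  fixes q :: "'v \<Rightarrow> (complex^2^2) \<times> (complex^2^2)"
  assumes q_add: "q (a + b) = q a + q b"
    and q_scale: "q (c \<cdot> a) = (entry_scale c (fst (q a)), entry_scale c (snd (q a)))"
    and q_br: "q (br a b) =
      (commutator (fst (q a)) (fst (q b)), commutator (snd (q a)) (snd (q b)))"
    and annihilates: "q u = 0 \<Longrightarrow> br a u = 0"
    and q_range: "range q = {s. trace (fst s) = 0 \<and> trace (snd s) = 0}"
begin

lemma q_zero: "q 0 = 0"
  using q_add[of 0 0] by simp

lemma q_diff: "q (a - b) = q a - q b"
  using q_add[of "a - b" b] by (simp add: algebra_simps)

lemma q_trace: "trace (fst (q a)) = 0" "trace (snd (q a)) = 0"
  using q_range by auto

lemma br_cong: "q a = q b \<Longrightarrow> br x a = br x b"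
  using annihilates[of "a - b" x] by (simp add: q_diff br_diff_right)

text \<open>An arbitrary representative can be chosen: by \<open>br_cong\<close> a right factor
  matters only through its image under \<open>q\<close>.\<close>

definition lift :: "gen \<Rightarrow> 'v" where
  "lift g = (SOME a. q a = gen_matrices g)"

lemma q_lift: "q (lift g) = gen_matrices g"
proof -
  have "gen_matrices g \<in> range q"
    unfolding q_range by (cases g) (auto simp: fst_snd_inject trace_basis)
  then have "\<exists>a. q a = gen_matrices g" by (metis imageE)
  then show ?thesis unfolding lift_def by (rule someI_ex)
qed

definition act :: "gen \<Rightarrow> 'v \<Rightarrow> 'v" where
  "act g v = br v (lift g)"

lemma act_linear: "Vector_Spaces.linear scl scl (act g)"
  unfolding act_def[abs_def] by (rule linear_left)

lemma act_commutator:
  "act b (act a v) - act a (act b v) = br v (br (lift a) (lift b))"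
  by (simp add: act_def leibniz)

text \<open>Reduces relations between operators on \<open>L\<close> to matrix identities: the
  Leibniz identity turns a commutator of right multiplications into one right
  multiplication.\<close>

lemma act_commutator_eq:
  assumes "q (br (lift a) (lift b)) = q w"
  shows "act b (act a v) - act a (act b v) = br v w"
  unfolding act_commutator by (rule br_cong) fact

lemmas q_simps = q_add q_diff q_scale q_br q_lift q_zero fst_snd_inject commutator_basis

lemma sl2_relations:
  "act (F i) (act (E i) v) - act (E i) (act (F i) v) = act (H i) v"
  "act (H i) (act (E i) v) - act (E i) (act (H i) v) = 2 \<cdot> act (E i) v"
  "act (F i) (act (H i) v) - act (H i) (act (F i) v) = 2 \<cdot> act (F i) v"
proof -
  have "q (br (lift (E i)) (lift (F i))) = q (lift (H i))"
    by (cases i) (simp_all add: q_simps)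
  from act_commutator_eq[OF this]
  show "act (F i) (act (E i) v) - act (E i) (act (F i) v) = act (H i) v"
    by (simp only: act_def)
  have "q (br (lift (E i)) (lift (H i))) = q (2 \<cdot> lift (E i))"
    by (cases i) (simp_all add: q_simps)
  from act_commutator_eq[OF this]
  show "act (H i) (act (E i) v) - act (E i) (act (H i) v) = 2 \<cdot> act (E i) v"
    by (simp only: act_def br_scale_right)
  have "q (br (lift (H i)) (lift (F i))) = q (2 \<cdot> lift (F i))"
    by (cases i) (simp_all add: q_simps)
  from act_commutator_eq[OF this]
  show "act (F i) (act (H i) v) - act (H i) (act (F i) v) = 2 \<cdot> act (F i) v"
    by (simp only: act_def br_scale_right)
qed

lemma act_commute:
  assumes "a \<in> {E First, F First, H First}" "b \<in> {E Second, F Second, H Second}"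
  shows "act a (act b v) = act b (act a v)"
proof -
  have "q (br (lift b) (lift a)) = q 0"
    using assms by (auto simp: q_simps zero_prod_def)
  from act_commutator_eq[OF this] show ?thesis by (simp add: br_zero)
qed

lemma sl2_triple_act: "sl2_triple scl Basis (act (E i)) (act (F i)) (act (H i))"
proof -
  interpret e: Vector_Spaces.linear scl scl "act (E i)" by (rule act_linear)
  interpret f: Vector_Spaces.linear scl scl "act (F i)" by (rule act_linear)
  interpret h: Vector_Spaces.linear scl scl "act (H i)" by (rule act_linear)
  show ?thesis
    by unfold_locales (rule sl2_relations)+
qed

sublocale commuting_sl2_triples scl Basis
  "act (E First)" "act (F First)" "act (H First)" "act (E Second)" "act (F Second)" "act (H Second)"
proof -
  interpret s1: sl2_triple scl Basis "act (E First)" "act (F First)" "act (H First)"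
    by (rule sl2_triple_act)
  interpret s2: sl2_triple scl Basis "act (E Second)" "act (F Second)" "act (H Second)"
    by (rule sl2_triple_act)
  show "commuting_sl2_triples scl Basis (act (E First)) (act (F First)) (act (H First))
     (act (E Second)) (act (F Second)) (act (H Second))"
    by unfold_locales (use act_commute in auto)
qed

text \<open>Links the action of arbitrary matrices, in which irreducibility is phrased, to the three
  operators of a triple.\<close>

lemma br_decomposition:
  assumes "q a = inject i A" "trace A = 0"
  shows "br x a = (A $ 1 $ 2) \<cdot> act (E i) x + (- (A $ 2 $ 1)) \<cdot> act (F i) x + (A $ 2 $ 2) \<cdot> act (H i) x"
proof -
  define b where "b = (A $ 1 $ 2) \<cdot> lift (E i) + (- (A $ 2 $ 1)) \<cdot> lift (F i) + (A $ 2 $ 2) \<cdot> lift (H i)"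
  have "q b = inject i (entry_scale (A $ 1 $ 2) mat_e + entry_scale (- (A $ 2 $ 1)) mat_f
     + entry_scale (A $ 2 $ 2) mat_h)"
    unfolding b_def by (cases i) (simp_all add: q_simps entry_scale_uminus)
  also have "\<dots> = q a"
    using assms traceless_decomposition[of A] by simp
  finally have "br x a = br x b" by (intro br_cong) simp
  then show ?thesis
    by (simp only: b_def act_def br_add_right br_scale_right)
qed

text \<open>The Casimir operator of the second copy acts on \<open>L/I\<close> with eigenvalues \<open>0\<close> and \<open>8\<close> and on \<open>I\<close>,
  a sum of two-dimensional modules of this copy, as multiplication by \<open>3\<close>. Hence \<open>t (t - 8)\<close>, which
  is \<open>-15\<close> at \<open>t = 3\<close>, yields an equivariant projection of \<open>L\<close> along \<open>I\<close>.\<close>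

definition levi :: "'v \<Rightarrow> 'v" where
  "levi a = a + (1 / 15) \<cdot> (s2.casimir (s2.casimir a) - 8 \<cdot> s2.casimir a)"

lemma q_act: "q (act g v) =
    (commutator (fst (q v)) (fst (gen_matrices g)), commutator (snd (q v)) (snd (gen_matrices g)))"
  by (simp add: act_def q_br q_lift)

text \<open>Brackets with the second copy vanish in the first component; the second component is the
  adjoint module.\<close>

lemma q_casimir: "q (s2.casimir a) = (0, entry_scale 8 (snd (q a)))"
  using adjoint_casimir[OF q_trace(2)[of a]]
  by (simp add: s2.casimir_def q_diff q_scale q_act commutator_basis)

lemma q_levi: "q (levi a) = q a"
  by (simp add: levi_def q_add q_scale q_diff q_casimir zero_prod_def[symmetric])

lemma levi_linear: "Vector_Spaces.linear scl scl levi"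
proof -
  interpret c: Vector_Spaces.linear scl scl s2.casimir by (rule s2.casimir_linear)
  show ?thesis
    unfolding Vector_Spaces.linear_iff levi_def using vector_space_axioms
    by (simp add: c.add c.scale algebra_simps scale_left_commute)
qed

lemma casimir_act:
  assumes "g \<in> sl2_gens"
  shows "s2.casimir (act g v) = act g (s2.casimir v)"
proof -
  interpret g: Vector_Spaces.linear scl scl "act g" by (rule act_linear)
  consider "g \<in> {E First, F First, H First}" | "g \<in> {E Second, F Second, H Second}"
    using assms by (auto simp: sl2_gens_def) (metis copy.exhaust)+
  then show ?thesis
  proof cases
    case 1
    then have "act b (act g x) = act g (act b x)" if "b \<in> {E Second, F Second, H Second}" for b x
      using act_commute that by metis
    then show ?thesis
      by (simp add: s2.casimir_def g.diff g.scale)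
  next
    case 2
    then show ?thesis by (auto simp: s2.casimir_commute)
  qed
qed

lemma levi_act:
  assumes "g \<in> sl2_gens"
  shows "levi (act g v) = act g (levi v)"
proof -
  interpret g: Vector_Spaces.linear scl scl "act g" by (rule act_linear)
  show ?thesis
    by (simp only: levi_def casimir_act[OF assms] g.add g.scale g.diff)
qed

end

section \<open>The multiplication table\<close>

lemma copy_UNIV: "(UNIV :: copy set) = {First, Second}"
  using copy.exhaust by auto

lemma gens_eq: "gens m = sl2_gens \<union> case_prod X ` (UNIV \<times> {..m})"
  by (auto simp: gens_def sl2_gens_def)

lemma finite_gens: "finite (gens m)"
  by (simp add: gens_eq sl2_gens_def copy_UNIV)

text \<open>The only product that could leave the span of \<open>gens m\<close> is that of
  \<open>X i m\<close> with \<open>F First\<close>, where the guard \<open>k < m\<close> gives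
  zero.\<close>

lemma table_closed:
  assumes "a \<in> gens m" "b \<in> gens m" "g \<notin> gens m"
  shows "Poly_Mapping.lookup (table m a b) g = 0"
proof -
  have E: "E i \<in> gens m" and F: "F i \<in> gens m" and H: "H i \<in> gens m"
    and X_mem: "X i k \<in> gens m \<longleftrightarrow> k \<le> m" for i k
    by (auto simp: gens_def)
  have single: "Poly_Mapping.lookup (Poly_Mapping.single g' c) g = (0 :: complex)" if "g' \<in> gens m" for g' c
    using that assms(3) by (metis lookup_single_not_eq)
  have small: "Poly_Mapping.lookup (if P then Poly_Mapping.single g' c else 0) g = (0 :: complex)"
    if "P \<Longrightarrow> g' \<in> gens m" for P g' c
    using single that by simp
  show ?thesis
  proof (cases a)
    case (X i k)
    then show ?thesis
      using assms(1) by (cases b; cases i; rename_tac j; case_tac j) (auto simp: X_mem intro!: small single)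
  qed (cases b; auto simp: E F H intro!: small single)+
qed

lemma lookup_map_mult: "Poly_Mapping.lookup (Poly_Mapping.map ((*) c) p) k = c * Poly_Mapping.lookup p k" for c :: complex
  by (simp add: Poly_Mapping.map.rep_eq when_def)

text \<open>Coefficients are attached to indices, the form needed for preimages under
  \<open>combination\<close>; a spanning vector is represented by any one of its indices.\<close>

lemma (in module) span_image_family:
  assumes "finite A" "x \<in> span (\<phi> ` A)"
  shows "\<exists>c. x = (\<Sum>i\<in>A. scale (c i) (\<phi> i))"
  using assms(2)
proof (induction rule: span_induct_alt)
  case base
  show ?case by (intro exI[of _ "\<lambda>_. 0"]) simp
next
  case (step a y z)
  then obtain i c where i: "i \<in> A" "y = \<phi> i" and c: "z = (\<Sum>i\<in>A. scale (c i) (\<phi> i))" by blast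
  have "(\<Sum>j\<in>A. scale (if j = i then a else 0) (\<phi> j)) = scale a (\<phi> i)"
    using assms(1) i(1) by (simp add: if_distrib[of "\<lambda>a. scale a _"] if_distribR cong: if_cong)
  then have "scale a y + z = (\<Sum>j\<in>A. scale ((if j = i then a else 0) + c j) (\<phi> j))"
    by (simp add: scale_left_distrib sum.distrib i c)
  then show ?case by (rule exI[where x = "\<lambda>j. (if j = i then a else 0) + c j"])
qed

text \<open>A basis of \<open>L\<close> defines a map from the table algebra to \<open>L\<close>,
  the direction opposite to the one required. Closure of the carrier lets the inverse respect the
  operations.\<close>

lemma calg_isomorphic_sym:
  assumes "calg_iso \<phi> A B"
    and "\<And>x y. x \<in> carrier A \<Longrightarrow> y \<in> carrier A \<Longrightarrow> vadd A x y \<in> carrier A"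
    and "\<And>c x. x \<in> carrier A \<Longrightarrow> vscale A c x \<in> carrier A"
    and "\<And>x y. x \<in> carrier A \<Longrightarrow> y \<in> carrier A \<Longrightarrow> bracket A x y \<in> carrier A"
  shows "calg_isomorphic B A"
proof -
  let ?f = "inv_into (carrier A) \<phi>"
  have bij: "bij_betw \<phi> (carrier A) (carrier B)" using assms(1) by (simp add: calg_iso_def)
  then have f: "?f y \<in> carrier A" "\<phi> (?f y) = y" if "y \<in> carrier B" for y
    using that by (auto simp: bij_betw_def inv_into_into f_inv_into_f)
  have eq: "?f y = x" if "x \<in> carrier A" "\<phi> x = y" for x y
    using that bij by (auto simp: bij_betw_def)
  have "calg_iso ?f B A"
    unfolding calg_iso_def
    using bij_betw_inv_into[OF bij] assms f by (auto intro!: eq simp: calg_iso_def)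
  then show ?thesis unfolding calg_isomorphic_def by blast
qed

section \<open>A basis of \<open>L\<close> that realises the table\<close>

locale standard_double_sl2_quotient = double_sl2_quotient scl br Basis q
  for scl :: "complex \<Rightarrow> 'v::ab_group_add \<Rightarrow> 'v" (infixr \<open>\<cdot>\<close> 75) and br Basis q +
  fixes m :: nat and p r
  assumes string_p: "s1.string m p" and string_r: "s1.string m r"
    and nonzero: "p \<noteq> 0" "r \<noteq> 0"
    and second_p: "act (E Second) p = r" "act (H Second) p = - p" "act (F Second) p = 0"
    and second_r: "act (E Second) r = 0" "act (H Second) r = r" "act (F Second) r = - p"
    and kernel: "{a. q a = 0} = span (orbit m p \<union> orbit m r)"
begin

lemma q_uminus: "q (- a) = - q a"
  using q_diff[of 0 a] by (simp add: q_zero)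

text \<open>Here \<open>p\<close> and \<open>r\<close> serve as x_0^1 and x_0^2. By
  \<open>levi_eq\<close> the values on the \<open>sl2\<close> generators are independent of the
  chosen representatives.\<close>

definition base :: "gen \<Rightarrow> 'v" where
  "base g = (case g of X First k \<Rightarrow> (act (F First) ^^ k) p | X Second k \<Rightarrow> (act (F First) ^^ k) r
     | _ \<Rightarrow> levi (lift g))"

lemma base_simps:
  "base (E i) = levi (lift (E i))" "base (F i) = levi (lift (F i))" "base (H i) = levi (lift (H i))"
  "base (X First k) = (act (F First) ^^ k) p" "base (X Second k) = (act (F First) ^^ k) r"
  by (simp_all add: base_def)

lemma base_sl2_gens: "g \<in> sl2_gens \<Longrightarrow> base g = levi (lift g)"
  by (auto simp: sl2_gens_def base_simps)

lemma base_X: "base (X i k) = (act (F First) ^^ k) (base (X i 0))"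
  by (cases i) (simp_all add: base_simps)

lemma string_base: "s1.string m (base (X i 0))"
  using string_p string_r by (cases i) (simp_all add: base_simps)

lemma kernel_base: "{a. q a = 0} = span (base ` case_prod X ` (UNIV \<times> {..m}))"
proof -
  have "base ` case_prod X ` (UNIV \<times> {..m}) = orbit m p \<union> orbit m r"
    by (auto simp: copy_UNIV base_simps image_iff)
  then show ?thesis by (simp add: kernel)
qed

lemma q_base_X: "k \<le> m \<Longrightarrow> q (base (X i k)) = 0"
  using kernel_base span_base[of "base (X i k)" "base ` case_prod X ` (UNIV \<times> {..m})"] by blast

lemma q_base: "g \<in> sl2_gens \<Longrightarrow> q (base g) = gen_matrices g"
  by (simp add: base_sl2_gens q_levi q_lift)

text \<open>The Casimir scalar 3 is computed at \<open>p\<close> and \<open>r\<close>, spreads along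
  both orbits because the operator commutes with the first copy, and so holds on the kernel.\<close>

lemma levi_kernel:
  assumes "q u = 0"
  shows "levi u = 0"
proof -
  interpret vp: vector_space_pair scl scl ..
  interpret c: Vector_Spaces.linear scl scl s2.casimir by (rule s2.casimir_linear)
  interpret three: Vector_Spaces.linear scl scl "\<lambda>v. 3 \<cdot> v"
    using vector_space_axioms by (simp add: Vector_Spaces.linear_iff scale_right_distrib mult.commute)
  interpret fk: Vector_Spaces.linear scl scl "act (F First) ^^ k" for k
    by (rule linear_funpow) (rule act_linear)
  have comm: "s2.casimir ((act (F First) ^^ k) v) = (act (F First) ^^ k) (s2.casimir v)" for k v
    by (induction k) (auto simp: casimir_act sl2_gens_def)
  have three_eq: "3 \<cdot> v = v + 2 \<cdot> v" for v :: 'v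
    using scale_left_distrib[of 1 2 v] by simp
  have "s2.casimir p = 3 \<cdot> p" "s2.casimir r = 3 \<cdot> r"
    by (simp_all add: s2.casimir_def second_p second_r s2.e.neg s2.h.neg three_eq)
  then have "s2.casimir x = 3 \<cdot> x" if "x \<in> orbit m p \<union> orbit m r" for x
    using that by (auto simp: comm fk.scale)
  then have "s2.casimir u = 3 \<cdot> u"
    using vp.linear_eq_on[OF s2.casimir_linear three.linear_axioms, of u "orbit m p \<union> orbit m r"]
      kernel assms by blast
  then have "levi u = u + (1 / 15) \<cdot> (-15) \<cdot> u"
    unfolding levi_def by (simp add: c.scale flip: scale_left_diff_distrib)
  then show ?thesis by simp
qed

text \<open>With \<open>q_levi\<close> and \<open>levi_act\<close>, this makes \<open>levi\<close>
  an equivariant section of \<open>q\<close>, whose image is the complement.\<close>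

lemma levi_eq:
  assumes "q a = q b"
  shows "levi a = levi b"
proof -
  interpret levi: Vector_Spaces.linear scl scl levi by (rule levi_linear)
  show ?thesis using levi_kernel[of "a - b"] assms by (simp add: q_diff levi.diff)
qed

lemma br_base: "b \<in> sl2_gens \<Longrightarrow> br x (base b) = act b x"
  unfolding act_def by (rule br_cong) (simp add: q_base q_lift)

text \<open>The right factor acts through its class, and \<open>levi\<close> commutes with this
  action. Hence the product is \<open>levi\<close> of the product of representatives.\<close>

lemma br_base_sl2_gens:
  assumes "a \<in> sl2_gens" "b \<in> sl2_gens" "g \<in> sl2_gens"
    and "q (br (lift a) (lift b)) = q (c \<cdot> lift g)"
  shows "br (base a) (base b) = c \<cdot> base g"
proof -
  interpret levi: Vector_Spaces.linear scl scl levi by (rule levi_linear)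
  have "br (base a) (base b) = levi (act b (lift a))"
    unfolding br_base[OF assms(2)] base_sl2_gens[OF assms(1)] levi_act[OF assms(2)] ..
  also have "\<dots> = levi (c \<cdot> lift g)"
    using assms(4) by (intro levi_eq) (simp add: act_def)
  finally show ?thesis by (simp add: levi.scale base_sl2_gens assms(3))
qed

lemma sl2_gens_mem: "E i \<in> sl2_gens" "F i \<in> sl2_gens" "H i \<in> sl2_gens"
  by (auto simp: sl2_gens_def)

text \<open>Vanishing products are written as zero multiples so that \<open>br_base_sl2_gens\<close>
  covers every case.\<close>

lemma br_base_sl2_gens_simps:
  "br (base (E i)) (base (H j)) = (if i = j then 2 else 0) \<cdot> base (E i)"
  "br (base (H i)) (base (E j)) = (if i = j then - 2 else 0) \<cdot> base (E i)"
  "br (base (E i)) (base (F j)) = (if i = j then 1 else 0) \<cdot> base (H i)"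
  "br (base (F i)) (base (E j)) = (if i = j then - 1 else 0) \<cdot> base (H i)"
  "br (base (H i)) (base (F j)) = (if i = j then 2 else 0) \<cdot> base (F i)"
  "br (base (F i)) (base (H j)) = (if i = j then - 2 else 0) \<cdot> base (F i)"
  "br (base (E i)) (base (E j)) = 0 \<cdot> base (E i)"
  "br (base (F i)) (base (F j)) = 0 \<cdot> base (F i)"
  "br (base (H i)) (base (H j)) = 0 \<cdot> base (H i)"
  by (rule br_base_sl2_gens; (rule sl2_gens_mem)?; cases i; cases j; simp add: q_simps q_uminus entry_scale_uminus zero_prod_def)+

lemma first_base_X:
  "act (H First) (base (X i k)) = (of_nat m - 2 * of_nat k) \<cdot> base (X i k)"
  "k \<le> m \<Longrightarrow> act (F First) (base (X i k)) = (if k < m then base (X i (Suc k)) else 0)"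
  "act (E First) (base (X i k)) =
     (if 1 \<le> k then (- (of_nat k * (of_nat m + 1 - of_nat k))) \<cdot> base (X i (k - 1)) else 0)"
proof -
  note s = s1.stringD[OF string_base[of i]]
  show "act (H First) (base (X i k)) = (of_nat m - 2 * of_nat k) \<cdot> base (X i k)"
    unfolding base_X[of i k] by (rule s(4))
  show "act (F First) (base (X i k)) = (if k < m then base (X i (Suc k)) else 0)" if "k \<le> m"
    unfolding base_X[of i k] base_X[of i "Suc k"] using s(3) that by (cases "k = m") auto
  show "act (E First) (base (X i k)) =
     (if 1 \<le> k then (- (of_nat k * (of_nat m + 1 - of_nat k))) \<cdot> base (X i (k - 1)) else 0)"
  proof (cases k)
    case 0
    then show ?thesis using s(1) by simp
  next
    case (Suc l)
    have "act (E First) (base (X i (Suc l))) =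
        (- (of_nat (Suc l) * (of_nat m - of_nat l))) \<cdot> base (X i l)"
      unfolding base_X[of i "Suc l"] base_X[of i l] by (rule s(5))
    then show ?thesis by (simp add: Suc)
  qed
qed

text \<open>The relations at \<open>p\<close> and \<open>r\<close> repeat at every level of the
  strings, as the second copy commutes with \<open>act (F First)\<close>.\<close>

lemma second_base_X:
  "act (E Second) (base (X First k)) = base (X Second k)"
  "act (H Second) (base (X First k)) = - base (X First k)"
  "act (F Second) (base (X First k)) = 0"
  "act (E Second) (base (X Second k)) = 0"
  "act (H Second) (base (X Second k)) = base (X Second k)"
  "act (F Second) (base (X Second k)) = - base (X First k)"
proof -
  interpret fk: Vector_Spaces.linear scl scl "act (F First) ^^ k"
    by (rule linear_funpow) (rule act_linear)
  note c = funpow_commute[of "act (F First)" "act g" k for g, simplified, symmetric]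
  show "act (E Second) (base (X First k)) = base (X Second k)"
    "act (H Second) (base (X First k)) = - base (X First k)"
    "act (F Second) (base (X First k)) = 0"
    "act (E Second) (base (X Second k)) = 0"
    "act (H Second) (base (X Second k)) = base (X Second k)"
    "act (F Second) (base (X Second k)) = - base (X First k)"
    by (simp_all add: base_simps c second_p second_r fk.neg)
qed

text \<open>Summing over \<open>gens m\<close> instead of the support makes additivity
  immediate.\<close>

definition combination :: "(gen \<Rightarrow>\<^sub>0 complex) \<Rightarrow> 'v" where
  "combination P = (\<Sum>g\<in>gens m. Poly_Mapping.lookup P g \<cdot> base g)"

lemma combination_add: "combination (P + Q) = combination P + combination Q"
  by (simp add: combination_def lookup_add scale_left_distrib sum.distrib)

lemma combination_zero: "combination 0 = 0"
  by (simp add: combination_def)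

lemma combination_sum: "combination (sum P A) = (\<Sum>i\<in>A. combination (P i))"
  by (induction A rule: infinite_finite_induct) (auto simp: combination_add combination_zero)

lemma combination_map: "combination (Poly_Mapping.map ((*) c) P) = c \<cdot> combination P"
  by (simp add: combination_def lookup_map_mult scale_sum_right)

lemma combination_single:
  assumes "g \<in> gens m"
  shows "combination (Poly_Mapping.single g c) = c \<cdot> base g"
proof -
  have "combination (Poly_Mapping.single g c) = (\<Sum>h\<in>{g}. Poly_Mapping.lookup (Poly_Mapping.single g c) h \<cdot> base h)"
    unfolding combination_def using assms finite_gens
    by (intro sum.mono_neutral_right) (auto simp: lookup_single_not_eq)
  then show ?thesis by simp
qed

lemma br_base_table:
  assumes "a \<in> gens m" "b \<in> gens m"
  shows "br (base a) (base b) = combination (table m a b)"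
proof -
  have G: "E i \<in> gens m" "F i \<in> gens m" "H i \<in> gens m" "X i k \<in> gens m \<longleftrightarrow> k \<le> m" for i k
    by (auto simp: gens_def)
  note comb = combination_single combination_zero G
  show ?thesis
  proof (cases b)
    case (X j l)
    then have "q (base b) = 0"
      using assms(2) q_base_X by (simp add: G)
    then have "br (base a) (base b) = 0"
      by (rule annihilates)
    moreover have "table m a b = 0" unfolding X by (cases a) auto
    ultimately show ?thesis by (simp add: combination_zero)
  next
    case (E j)
    show ?thesis
    proof (cases a)
      case (X i k)
      with assms show ?thesis
        unfolding E X br_base[OF sl2_gens_mem(1)]
        by (cases j; cases i) (auto simp: comb first_base_X second_base_X)
    qed (simp_all add: E br_base_sl2_gens_simps comb)
  next
    case (F j)
    show ?thesis
    proof (cases a)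
      case (X i k)
      with assms show ?thesis
        unfolding F X br_base[OF sl2_gens_mem(2)]
        by (cases j; cases i) (auto simp: comb first_base_X second_base_X)
    qed (simp_all add: F br_base_sl2_gens_simps comb)
  next
    case (H j)
    show ?thesis
    proof (cases a)
      case (X i k)
      with assms show ?thesis
        unfolding H X br_base[OF sl2_gens_mem(3)]
        by (cases j; cases i) (auto simp: comb first_base_X second_base_X)
    qed (simp_all add: H br_base_sl2_gens_simps comb)
  qed
qed

text \<open>Applying \<open>q\<close> kills the ideal part of a relation, and independent matrices
  remain; after that only simultaneous eigenvectors in the ideal are left.\<close>

lemma base_scalars_zero:
  assumes s: "(\<Sum>g\<in>gens m. c g \<cdot> base g) = 0" and g: "g \<in> gens m"
  shows "c g = 0"
proof -
  let ?A = "case_prod X ` (UNIV \<times> {..m})"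
  have disj: "sl2_gens \<inter> ?A = {}" by (auto simp: sl2_gens_def)
  have fin: "finite sl2_gens" "finite ?A" by (auto simp: sl2_gens_def copy_UNIV)
  have split: "(\<Sum>g\<in>gens m. c g \<cdot> base g) = (\<Sum>g\<in>sl2_gens. c g \<cdot> base g) + (\<Sum>g\<in>?A. c g \<cdot> base g)"
    unfolding gens_eq by (rule sum.union_disjoint[OF fin disj])
  have "(\<Sum>g\<in>?A. c g \<cdot> base g) \<in> {a. q a = 0}"
    unfolding kernel_base by (intro span_sum span_scale span_base) auto
  then have "q (\<Sum>g\<in>sl2_gens. c g \<cdot> base g) = q (\<Sum>g\<in>gens m. c g \<cdot> base g)"
    unfolding split q_add by simp
  then have q0: "q (\<Sum>g\<in>sl2_gens. c g \<cdot> base g) = 0"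
    by (simp only: s q_zero)
  have sl2_gens_list: "sl2_gens = {E First, E Second, F First, F Second, H First, H Second}"
    by (auto simp: sl2_gens_def copy_UNIV)
  let ?t = "\<lambda>i. entry_scale (c (E i)) mat_e + entry_scale (c (F i)) mat_f + entry_scale (c (H i)) mat_h"
  have "(\<Sum>g\<in>sl2_gens. c g \<cdot> base g) = (c (E First) \<cdot> base (E First) + c (F First) \<cdot> base (F First)
      + c (H First) \<cdot> base (H First)) + (c (E Second) \<cdot> base (E Second) + c (F Second) \<cdot> base (F Second)
      + c (H Second) \<cdot> base (H Second))"
    unfolding sl2_gens_list by simp
  also have "q \<dots> = (?t First, ?t Second)"
    by (simp add: q_add q_scale q_base[OF sl2_gens_mem(1)] q_base[OF sl2_gens_mem(2)]
        q_base[OF sl2_gens_mem(3)])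
  finally have "(?t First, ?t Second) = 0" using q0 by simp
  then have "?t i = 0" for i
    by (cases i) (simp_all add: zero_prod_def)
  from basis_combination_eq_0[OF this] have z: "c g = 0" if "g \<in> sl2_gens" for g
    using that by (auto simp: sl2_gens_def)
  \<comment> \<open>The eigenvalues of \<open>h1\<close> and \<open>h2\<close> on the basis of \<open>I\<close> are real, so \<open>h1 + \<i> h2\<close> separates the pairs.\<close>
  define T where "T = (\<lambda>v. act (H First) v + \<i> \<cdot> act (H Second) v)"
  define \<mu> where "\<mu> = (\<lambda>g. case g of X First k \<Rightarrow> of_nat m - 2 * of_nat k - \<i>
     | X Second k \<Rightarrow> of_nat m - 2 * of_nat k + \<i> | _ \<Rightarrow> 0)"
  have T: "Vector_Spaces.linear scl scl T"
    unfolding Vector_Spaces.linear_iff T_def using vector_space_axioms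
    by (simp add: s1.h.add s2.h.add s1.h.scale s2.h.scale scale_right_distrib mult.commute)
  have ev: "T (base g) = \<mu> g \<cdot> base g" "base g \<noteq> 0" if "g \<in> ?A" for g
  proof -
    from that obtain i k where g: "g = X i k" "k \<le> m" by auto
    show "T (base g) = \<mu> g \<cdot> base g"
      unfolding g T_def \<mu>_def
      by (cases i) (simp_all add: first_base_X second_base_X scale_left_diff_distrib scale_left_distrib)
    have "base (X i 0) \<noteq> 0"
      using nonzero by (cases i) (simp_all add: base_simps)
    then show "base g \<noteq> 0"
      unfolding g base_X[of i k] by (rule s1.string_nonzero[OF string_base _ g(2)])
  qed
  have inj: "inj_on \<mu> ?A"
    by (rule inj_onI) (auto simp: \<mu>_def complex_eq_iff split: copy.splits)
  have "(\<Sum>g\<in>?A. c g \<cdot> base g) = 0"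
    using s split z by simp
  from eigenvectors_scalars_zero[OF T fin(2) ev inj this] z g show ?thesis
    by (auto simp: gens_eq)
qed

text \<open>Subtracting the combination of \<open>sl2\<close> basis vectors with the same matrices
  leaves an element of the kernel.\<close>

lemma span_base_gens: "a \<in> span (base ` gens m)"
proof -
  let ?S = "span (base ` gens m)"
  have mem: "c \<cdot> base g \<in> ?S" if "g \<in> sl2_gens" for g c
    using that by (intro span_scale span_base) (auto simp: gens_eq)
  define b :: "copy \<Rightarrow> complex^2^2 \<Rightarrow> 'v" where "b = (\<lambda>i A. (A $ 1 $ 2) \<cdot> base (E i) + (- (A $ 2 $ 1)) \<cdot> base (F i)
     + (A $ 2 $ 2) \<cdot> base (H i))"
  have b: "b i A \<in> ?S" for i and A :: "complex^2^2"
    unfolding b_def by (intro span_add mem sl2_gens_mem)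
  have qb: "q (b i A) = inject i A" if "trace A = 0" for i A
  proof -
    have "q (b i A) = inject i (entry_scale (A $ 1 $ 2) mat_e + entry_scale (- (A $ 2 $ 1)) mat_f
       + entry_scale (A $ 2 $ 2) mat_h)"
      unfolding b_def
      by (cases i) (simp_all add: q_simps q_base sl2_gens_mem entry_scale_uminus)
    then show ?thesis using traceless_decomposition[OF that] by simp
  qed
  define d where "d = a - (b First (fst (q a)) + b Second (snd (q a)))"
  have "q d = 0"
    by (simp add: d_def q_diff q_add qb q_trace prod_eq_iff)
  then have "d \<in> span (base ` case_prod X ` (UNIV \<times> {..m}))"
    using kernel_base by blast
  also have "\<dots> \<subseteq> ?S"
    by (intro span_mono image_mono) (auto simp: gens_eq)
  finally have "d \<in> ?S" .
  moreover have "a = d + (b First (fst (q a)) + b Second (snd (q a)))"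
    by (simp add: d_def)
  ultimately show ?thesis using b by (metis span_add)
qed

lemma isomorphic_table_alg: "calg_isomorphic (alg_of scl br) (table_alg m)"
proof (rule calg_isomorphic_sym)
  have supp: "P \<in> carrier (table_alg m) \<longleftrightarrow> (\<forall>g. g \<notin> gens m \<longrightarrow> Poly_Mapping.lookup P g = 0)" for P
    by (auto simp: table_alg_def in_keys_iff)
  show "vadd (table_alg m) P Q \<in> carrier (table_alg m)"
    if "P \<in> carrier (table_alg m)" "Q \<in> carrier (table_alg m)" for P Q
    using that unfolding supp by (simp add: table_alg_def lookup_add)
  show "vscale (table_alg m) c P \<in> carrier (table_alg m)" if "P \<in> carrier (table_alg m)" for c P
    using that unfolding supp by (simp add: table_alg_def lookup_map_mult)
  have keys: "Poly_Mapping.keys P \<subseteq> gens m" if "P \<in> carrier (table_alg m)" for P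
    using that by (simp add: table_alg_def)
  show "bracket (table_alg m) P Q \<in> carrier (table_alg m)"
    if "P \<in> carrier (table_alg m)" "Q \<in> carrier (table_alg m)" for P Q
    unfolding supp using keys[OF that(1)] keys[OF that(2)]
    by (auto simp: table_alg_def lookup_sum lookup_map_mult table_closed subset_iff intro!: sum.neutral)
  have comb_keys: "combination P = (\<Sum>g\<in>Poly_Mapping.keys P. Poly_Mapping.lookup P g \<cdot> base g)"
    if "P \<in> carrier (table_alg m)" for P
    unfolding combination_def using keys[OF that] finite_gens
    by (intro sum.mono_neutral_right) (auto simp: in_keys_iff)
  have br: "combination (bracket (table_alg m) P Q) = br (combination P) (combination Q)"
    if "P \<in> carrier (table_alg m)" "Q \<in> carrier (table_alg m)" for P Q
  proof -
    have "combination (bracket (table_alg m) P Q) = (\<Sum>a\<in>Poly_Mapping.keys P. \<Sum>b\<in>Poly_Mapping.keys Q.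
        (Poly_Mapping.lookup P a * Poly_Mapping.lookup Q b) \<cdot> br (base a) (base b))"
      using keys[OF that(1)] keys[OF that(2)]
      by (auto simp: table_alg_def combination_sum combination_map br_base_table subset_iff intro!: sum.cong)
    also have "\<dots> = br (combination P) (combination Q)"
      unfolding comb_keys[OF that(1)] comb_keys[OF that(2)]
      by (simp only: br_sum_left br_scale_left)
        (simp add: br_sum_right br_scale_right scale_sum_right)
    finally show ?thesis .
  qed
  have "inj_on combination (carrier (table_alg m))"
  proof (rule inj_onI)
    fix P Q assume PQ: "P \<in> carrier (table_alg m)" "Q \<in> carrier (table_alg m)"
      "combination P = combination Q"
    have "(\<Sum>g\<in>gens m. (Poly_Mapping.lookup P g - Poly_Mapping.lookup Q g) \<cdot> base g) = 0"
      using PQ(3) by (simp add: combination_def scale_left_diff_distrib sum_subtractf)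
    from base_scalars_zero[OF this] have "Poly_Mapping.lookup P g = Poly_Mapping.lookup Q g" for g
      using PQ(1,2) unfolding supp by (cases "g \<in> gens m") auto
    then show "P = Q" by (intro poly_mapping_eqI)
  qed
  moreover have "\<exists>P\<in>carrier (table_alg m). combination P = a" for a
  proof -
    obtain c where c: "a = (\<Sum>g\<in>gens m. c g \<cdot> base g)"
      using span_image_family[OF finite_gens span_base_gens] by blast
    let ?P = "\<Sum>g\<in>gens m. Poly_Mapping.single g (c g)"
    have "?P \<in> carrier (table_alg m)"
      unfolding supp lookup_sum by (metis (mono_tags, lifting) lookup_single_not_eq sum.neutral)
    moreover have "combination ?P = a"
      by (simp add: combination_sum combination_single c)
    ultimately show ?thesis by blast
  qed
  ultimately have "bij_betw combination (carrier (table_alg m)) UNIV"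
    unfolding bij_betw_def by (auto simp: image_iff) (metis)
  then show "calg_iso combination (table_alg m) (alg_of scl br)"
    unfolding calg_iso_def using br
    by (simp add: alg_of_def) (simp add: table_alg_def combination_add combination_map)
qed

end

section \<open>From the hypotheses of the theorem to the operators\<close>

context double_sl2_quotient
begin

text \<open>A subspace stable under the three operators is stable under all traceless matrices, and
  the other module axioms are inherited from \<open>V\<close>.\<close>

lemma irreducible_module_act:
  assumes \<rho>: "\<forall>x A. trace A = 0 \<longrightarrow>
      \<rho> x A = (A $ 1 $ 2) \<cdot> act (E i) x + (- (A $ 2 $ 1)) \<cdot> act (F i) x + (A $ 2 $ 2) \<cdot> act (H i) x"
    and irr: "irreducible_module scl sl2 \<rho> V"
  shows "subspace V" "V \<noteq> {0}" "act (E i) ` V \<subseteq> V" "act (F i) ` V \<subseteq> V" "act (H i) ` V \<subseteq> V"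
    and "\<And>W. subspace W \<Longrightarrow> W \<subseteq> V \<Longrightarrow> act (E i) ` W \<subseteq> W \<Longrightarrow> act (F i) ` W \<subseteq> W \<Longrightarrow>
      act (H i) ` W \<subseteq> W \<Longrightarrow> W = {0} \<or> W = V"
proof -
  have V: "right_module scl sl2 \<rho> V" and "V \<noteq> {0}"
    and sub: "\<And>W. W \<subseteq> V \<Longrightarrow> right_module scl sl2 \<rho> W \<Longrightarrow> W = {0} \<or> W = V"
    using irr by (auto simp: irreducible_module_def)
  then show "subspace V" "V \<noteq> {0}" by (auto simp: right_module_def)
  have carrier: "A \<in> carrier sl2 \<longleftrightarrow> trace A = 0" for A by (simp add: sl2_def)
  have "\<rho> x mat_e = act (E i) x" "\<rho> x mat_f = act (F i) x" "\<rho> x mat_h = act (H i) x" for x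
    using \<rho> trace_basis by (simp_all add: mat_e_def mat_f_def mat_h_def)
  moreover have "\<rho> x A \<in> V" if "x \<in> V" "trace A = 0" for x A
    using V that by (simp add: right_module_def carrier)
  ultimately show "act (E i) ` V \<subseteq> V" "act (F i) ` V \<subseteq> V" "act (H i) ` V \<subseteq> V"
    using trace_basis by (metis image_subsetI)+
  fix W assume W: "subspace W" "W \<subseteq> V" "act (E i) ` W \<subseteq> W" "act (F i) ` W \<subseteq> W" "act (H i) ` W \<subseteq> W"
  have "\<rho> x A \<in> W" if "x \<in> W" "trace A = 0" for x A
    unfolding \<rho>[rule_format, OF that(2)] using W that(1) by (intro subspace_add subspace_scale) auto
  then have "right_module scl sl2 \<rho> W"
    using V W(1,2) unfolding right_module_def by (auto simp: subset_iff carrier)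
  with sub W(2) show "W = {0} \<or> W = V" by blast
qed

end

lemma double_sl2_quotient_of_iso:
  assumes L: "leibniz_algebra scl br" and vs: "complex_vector_space scl B"
    and I: "is_ideal scl br I" "\<And>u a. u \<in> I \<Longrightarrow> br a u = 0"
    and iso: "calg_iso \<psi> (calg_prod sl2 sl2) (quotient_alg scl br I)"
  shows "\<exists>q. double_sl2_quotient scl br B q \<and> {a. q a = 0} = I \<and> (\<forall>a. \<psi> (q a) = a +o I)"
proof -
  interpret leibniz_algebra scl br by fact
  interpret complex_vector_space scl B by fact
  have J: "subspace I" using I(1) by (simp add: is_ideal_def)
  let ?C = "carrier (calg_prod sl2 sl2)"
  have C: "s \<in> ?C \<longleftrightarrow> trace (fst s) = 0 \<and> trace (snd s) = 0" for s
    by (cases s) (simp add: calg_prod_def sl2_def)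
  have Q: "carrier (quotient_alg scl br I) = range (\<lambda>x. x +o I)"
    by (simp add: quotient_alg_def)
  have bij: "bij_betw \<psi> ?C (range (\<lambda>x. x +o I))"
    using iso by (simp add: calg_iso_def Q)
  define q where "q = (\<lambda>a. inv_into ?C \<psi> (a +o I))"
  have q: "q a \<in> ?C" "\<psi> (q a) = a +o I" for a
    using bij by (auto simp: q_def bij_betw_def inv_into_into f_inv_into_f)
  \<comment> \<open>Since \<open>\<psi>\<close> is injective, values of \<open>q\<close> can be
    checked after applying \<open>\<psi>\<close>; the homomorphism laws are transported in this
    way.\<close>
  have eq: "q a = s" if "s \<in> ?C" "\<psi> s = a +o I" for a s
    using bij that unfolding q_def bij_betw_def by (metis inv_into_f_f)
  have add: "q (a + b) = q a + q b" for a b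
  proof (rule eq)
    show "q a + q b \<in> ?C"
      using q(1)[of a] q(1)[of b] by (simp add: C trace_add)
    have "vadd (calg_prod sl2 sl2) (q a) (q b) = q a + q b"
      by (simp add: calg_prod_def sl2_def prod_eq_iff)
    then have "\<psi> (q a + q b) = vadd (quotient_alg scl br I) (\<psi> (q a)) (\<psi> (q b))"
      using iso q(1) unfolding calg_iso_def by metis
    then show "\<psi> (q a + q b) = (a + b) +o I"
      by (simp add: q(2) quotient_alg_simps[OF I(1)])
  qed
  have scale: "q (scl c a) = (entry_scale c (fst (q a)), entry_scale c (snd (q a)))" for c a
  proof (rule eq)
    let ?s = "(entry_scale c (fst (q a)), entry_scale c (snd (q a)))"
    show "?s \<in> ?C"
      using q(1)[of a] by (simp add: C trace_def entry_scale_def flip: sum_distrib_left)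
    have "vscale (calg_prod sl2 sl2) c (q a) = ?s"
      by (simp add: calg_prod_def sl2_def entry_scale_def)
    then have "\<psi> ?s = vscale (quotient_alg scl br I) c (\<psi> (q a))"
      using iso q(1) unfolding calg_iso_def by metis
    then show "\<psi> ?s = scl c a +o I"
      by (simp add: q(2) quotient_alg_simps[OF I(1)])
  qed
  have brk: "q (br a b) = (commutator (fst (q a)) (fst (q b)), commutator (snd (q a)) (snd (q b)))"
    for a b
  proof (rule eq)
    let ?s = "(commutator (fst (q a)) (fst (q b)), commutator (snd (q a)) (snd (q b)))"
    show "?s \<in> ?C"
      by (simp add: C commutator_def trace_sub trace_mul_sym[of "fst (q b)" "fst (q a)"]
          trace_mul_sym[of "snd (q b)" "snd (q a)"])
    have "bracket (calg_prod sl2 sl2) (q a) (q b) = ?s"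
      by (simp add: calg_prod_def sl2_def commutator_def)
    then have "\<psi> ?s = bracket (quotient_alg scl br I) (\<psi> (q a)) (\<psi> (q b))"
      using iso q(1) unfolding calg_iso_def by metis
    then show "\<psi> ?s = br a b +o I"
      by (simp add: q(2) quotient_alg_simps[OF I(1)])
  qed
  have zero: "q 0 = 0" using add[of 0 0] by simp
  have kernel: "q a = 0 \<longleftrightarrow> a \<in> I" for a
  proof
    assume "q a = 0"
    then have "a +o I = 0 +o I" using q(2)[of a] q(2)[of 0] zero by simp
    then show "a \<in> I" using coset_eq_iff[OF J, of a 0] by simp
  next
    assume "a \<in> I"
    then have "a +o I = 0 +o I" using coset_eq_iff[OF J, of a 0] by simp
    then show "q a = 0" using zero by (simp add: q_def)
  qed
  have range: "range q = {s. trace (fst s) = 0 \<and> trace (snd s) = 0}"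
  proof (intro subset_antisym subsetI)
    fix s :: "(complex^2^2) \<times> (complex^2^2)"
    assume "s \<in> {s. trace (fst s) = 0 \<and> trace (snd s) = 0}"
    then have s: "s \<in> ?C" by (simp add: C)
    then have "\<psi> s \<in> range (\<lambda>x. x +o I)" using bij_betwE[OF bij] by blast
    then obtain a where "\<psi> s = a +o I" by blast
    with eq[OF s] show "s \<in> range q" by blast
  qed (use q(1) C in auto)
  have "double_sl2_quotient scl br B q"
    by unfold_locales (use add scale brk range kernel I(2) in auto)
  with kernel q(2) show ?thesis by blast
qed

lemma internal_direct_sum_summand:
  fixes V :: "'j \<Rightarrow> 'v::ab_group_add set"
  assumes sum: "internal_direct_sum J V I" and "finite J" "j \<in> J" and zero: "\<And>i. i \<in> J \<Longrightarrow> 0 \<in> V i"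
  shows "V j \<subseteq> I" and "i \<in> J \<Longrightarrow> i \<noteq> j \<Longrightarrow> V i \<inter> V j \<subseteq> {0}"
proof -
  \<comment> \<open>The family with \<open>x\<close> at index \<open>i\<close> and zero elsewhere;
    \<open>restrict\<close> supplies the value \<open>undefined\<close> that
    \<open>Pi\<^sub>E\<close> demands outside \<open>J\<close>.\<close>
  define s where "s = (\<lambda>i x. restrict (\<lambda>k. if k = i then x else (0::'v)) J)"
  have s: "s i x \<in> Pi\<^sub>E J V" "(\<Sum>k\<in>J. s i x k) = x" if "i \<in> J" "x \<in> V i" for i x
    using that zero \<open>finite J\<close> by (auto simp: s_def)
  have bij: "bij_betw (\<lambda>v. \<Sum>j\<in>J. v j) (Pi\<^sub>E J V) I"
    using sum by (simp add: internal_direct_sum_def)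
  show "V j \<subseteq> I"
    using bij s[OF \<open>j \<in> J\<close>] unfolding bij_betw_def by (metis image_eqI subsetI)
  assume i: "i \<in> J" "i \<noteq> j"
  show "V i \<inter> V j \<subseteq> {0}"
  proof
    fix x assume "x \<in> V i \<inter> V j"
    \<comment> \<open>A common element of two summands is the sum of both families, and sums
      determine families.\<close>
    then have "s i x = s j x"
      using s[of i x] s[of j x] i \<open>j \<in> J\<close>
      by (intro inj_onD[OF bij_betw_imp_inj_on[OF bij]]) auto
    then have "s i x i = s j x i" by simp
    then show "x \<in> {0}" using i by (simp add: s_def)
  qed
qed

lemma internal_direct_sumE:
  assumes "internal_direct_sum J V I" "x \<in> I"
  obtains v where "\<And>j. j \<in> J \<Longrightarrow> v j \<in> V j" "x = (\<Sum>j\<in>J. v j)"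
  using assms unfolding internal_direct_sum_def bij_betw_def by (blast dest: PiE_mem)

theorem theorem4p2:
  fixes scl :: "complex \<Rightarrow> 'l::ab_group_add \<Rightarrow> 'l"
    and br :: "'l \<Rightarrow> 'l \<Rightarrow> 'l"
    and I :: "'l set"
    and \<psi> :: "(complex^2^2) \<times> (complex^2^2) \<Rightarrow> 'l set"
    and I1 :: "nat \<Rightarrow> 'l set"
    and I2 :: "nat \<Rightarrow> 'l set"
    and m :: nat
  assumes "leibniz_algebra scl br"
    and "I = squares_ideal scl br"
    and "calg_iso \<psi> (calg_prod sl2 sl2) (quotient_alg scl br I)"
    and "internal_direct_sum {1..2} I1 I"
    and "\<And>k. k \<in> {1..2} \<Longrightarrow> irreducible_module scl sl2 (sl2_act br \<psi> First) (I1 k)"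
    and "\<And>k. k \<in> {1..2} \<Longrightarrow> vector_space.dim scl (I1 k) = m + 1"
    and "internal_direct_sum {1..m + 1} I2 I"
    and "\<And>k. k \<in> {1..m + 1} \<Longrightarrow> irreducible_module scl sl2 (sl2_act br \<psi> Second) (I2 k)"
  shows "calg_isomorphic (alg_of scl br) (table_alg m)"
proof -
  interpret leibniz_algebra scl br by fact
  obtain S where "finite S" "span S = UNIV" using finite_dimensional by blast
  then obtain B where "independent B" "span B = UNIV" "finite B"
    using maximal_independent_subset[of S] by (metis finite_subset span_mono span_span top.extremum_uniqueI)
  then interpret complex_vector_space scl B
    by unfold_locales
  have ideal: "is_ideal scl br I"
    unfolding assms(2) by (rule squares_ideal_is_ideal)
  have ann: "br a u = 0" if "u \<in> I" for a u
    using that unfolding assms(2) by (rule squares_ideal_annihilates)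
  have J: "subspace I" using ideal by (simp add: is_ideal_def)
  obtain q where "double_sl2_quotient scl br B q"
    and kernel: "{a. q a = 0} = I" and \<psi>: "\<And>a. \<psi> (q a) = a +o I"
    using double_sl2_quotient_of_iso[OF assms(1) complex_vector_space_axioms ideal ann assms(3)] by blast
  then interpret double_sl2_quotient scl br B q by simp
  \<comment> \<open>The action defined through cosets agrees with the operators \<open>act\<close>,
    so the irreducibility hypotheses apply to the two triples.\<close>
  have \<rho>: "\<forall>x A. trace A = 0 \<longrightarrow> sl2_act br \<psi> i x A =
      scl (A $ 1 $ 2) (act (E i) x) + scl (- (A $ 2 $ 1)) (act (F i) x) + scl (A $ 2 $ 2) (act (H i) x)"
    for i
  proof (intro allI impI)
    fix x and A :: "complex^2^2" assume A: "trace A = 0"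
    have "inject i A \<in> range q"
      unfolding q_range using A by (simp add: fst_snd_inject trace_basis)
    then obtain a where a: "q a = inject i A" by (metis imageE)
    then have "sl2_act br \<psi> i x A = br x a"
      using \<psi>[of a] quotient_act_coset[OF J ann] by (simp add: sl2_act_def)
    then show "sl2_act br \<psi> i x A = scl (A $ 1 $ 2) (act (E i) x)
        + scl (- (A $ 2 $ 1)) (act (F i) x) + scl (A $ 2 $ 2) (act (H i) x)"
      using br_decomposition[OF a A] by simp
  qed
  note irr1 = irreducible_module_act[OF \<rho> assms(5)]
  note irr2 = irreducible_module_act[OF \<rho> assms(8)]
  have "0 \<in> I1 k" if "k \<in> {1..2}" for k
    using irr1(1)[OF that] by (rule subspace_0)
  note summand1 = internal_direct_sum_summand[OF assms(4) finite_atLeastAtMost _ this]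
  have I1_sub: "I1 1 \<subseteq> I" "I1 2 \<subseteq> I" and I1_disj: "I1 2 \<inter> I1 1 \<subseteq> {0}"
    by (rule summand1; simp)+
  have "0 \<in> I2 k" if "k \<in> {1..m + 1}" for k
    using irr2(1)[OF that] by (rule subspace_0)
  note summand2 = internal_direct_sum_summand(1)[OF assms(7) finite_atLeastAtMost _ this]
  have nontriv: "\<exists>u\<in>I. act (E Second) u \<noteq> 0 \<or> act (F Second) u \<noteq> 0 \<or> act (H Second) u \<noteq> 0"
  proof (rule ccontr)
    assume "\<not> ?thesis"
    then have triv: "act g u = 0" if "g \<in> {E Second, F Second, H Second}" "u \<in> I" for g u
      using that by auto
    have "\<exists>w. I2 k = span {w}" if k: "k \<in> {1..m + 1}" for k
    proof -
      have "I2 k \<subseteq> I"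
        using k by (rule summand2)
      obtain w where w: "w \<in> I2 k" "w \<noteq> 0"
        using irr2(1,2)[OF k] subspace_0 by blast
      have sub: "span {w} \<subseteq> I2 k"
        using w irr2(1)[OF k] by (intro span_minimal) auto
      have "act g ` span {w} \<subseteq> span {w}" if "g \<in> {E Second, F Second, H Second}" for g
        using triv[OF that] sub \<open>I2 k \<subseteq> I\<close> span_zero by (metis image_subsetI subsetD)
      then have "span {w} = {0} \<or> span {w} = I2 k"
        using irr2(6)[OF k _ sub] by simp
      moreover have "span {w} \<noteq> {0}"
        using w(2) span_base[of w "{w}"] by auto
      ultimately show ?thesis by auto
    qed
    then obtain w where w: "\<And>k. k \<in> {1..m + 1} \<Longrightarrow> I2 k = span {w k}" by metis
    have "I \<subseteq> span (w ` {1..m + 1})"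
    proof
      fix x assume "x \<in> I"
      then obtain v where v: "\<And>k. k \<in> {1..m + 1} \<Longrightarrow> v k \<in> I2 k" "x = (\<Sum>k\<in>{1..m + 1}. v k)"
        using internal_direct_sumE[OF assms(7)] by metis
      have "v k \<in> span (w ` {1..m + 1})" if "k \<in> {1..m + 1}" for k
        using v(1)[OF that] w[OF that] span_mono[of "{w k}" "w ` {1..m + 1}"] that by blast
      then show "x \<in> span (w ` {1..m + 1})" unfolding v(2) by (intro span_sum)
    qed
    then have "dim I \<le> card (w ` {1..m + 1})" by (intro dim_le_card) auto
    also have "\<dots> \<le> m + 1" using card_image_le[of "{1..m + 1}" w] by simp
    \<comment> \<open>The bound m + 1 is already the dimension of the first summand; that summand
      fills \<open>I\<close> and leaves nothing nonzero for the second.\<close>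
    finally have "dim I \<le> dim (I1 1)" using assms(6)[of 1] by simp
    then have "I1 1 = I"
      using subspace_dim_equal[OF irr1(1) J I1_sub(1)] by simp
    then have "I1 2 \<subseteq> {0}" using I1_sub(2) I1_disj by blast
    then show False using irr1(1,2)[of 2] subspace_0 by force
  qed
  have "\<exists>v. v \<in> I1 k \<and> s1.string m v \<and> I1 k = span (orbit m v)" if "k \<in> {1..2}" for k
    using s1.irreducible_string[OF irr1(1-6)[OF that]] assms(6)[OF that] that by auto
  then obtain v where v: "\<And>k. k \<in> {1..2} \<Longrightarrow> s1.string m (v k) \<and> I1 k = span (orbit m (v k))"
    by metis
  have span_I: "I = span (orbit m (v 1) \<union> orbit m (v 2))"
  proof
    show "I \<subseteq> span (orbit m (v 1) \<union> orbit m (v 2))"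
    proof
      fix x assume "x \<in> I"
      then obtain u where u: "\<And>k. k \<in> {1..2} \<Longrightarrow> u k \<in> I1 k" "x = (\<Sum>k\<in>{1..2::nat}. u k)"
        using internal_direct_sumE[OF assms(4)] by metis
      have "x = u 1 + u 2" unfolding u(2) by (simp add: numeral_2_eq_2)
      then show "x \<in> span (orbit m (v 1) \<union> orbit m (v 2))"
        using u(1)[of 1] u(1)[of 2] v[of 1] v[of 2] unfolding span_Un by auto
    qed
    have "span (orbit m (v 1)) \<subseteq> I" "span (orbit m (v 2)) \<subseteq> I"
      using v[of 1] v[of 2] I1_sub by auto
    then have "orbit m (v 1) \<subseteq> I" "orbit m (v 2) \<subseteq> I"
      using span_superset order_trans by metis+
    then show "span (orbit m (v 1) \<union> orbit m (v 2)) \<subseteq> I"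
      using J by (intro span_minimal) auto
  qed
  have act_I: "act g ` I \<subseteq> I" for g
    using ideal by (auto simp: is_ideal_def act_def)
  obtain p r where "p \<noteq> 0" "r \<noteq> 0" "s1.string m p" "s1.string m r"
    "act (E Second) p = r" "act (H Second) p = - p" "act (F Second) p = 0"
    "act (E Second) r = 0" "act (H Second) r = r" "act (F Second) r = - p"
    "I = span (orbit m p \<union> orbit m r)"
    using standard_pair[OF J act_I act_I act_I act_I _ _ span_I nontriv] v by auto
  then interpret standard_double_sl2_quotient scl br B q m p r
    by unfold_locales (simp_all add: kernel)
  show ?thesis by (rule isomorphic_table_alg)
qed

end
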